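(* Consider the generalized PORT model with parameter $\beta>0$. Let $k\in \mathbb{Z}_+$ and $x=(x_1, \ldots, x_k)\in \mathcal N$ be fixed. Then \[\frac{\deg(x, G_n)}{n^{1/(1+\beta)}}\rightarrow \zeta_x\] with probability 1, with some nondegenerate random variable $\zeta_x$. The distribution of $\zeta_x$ is the same as the distribution of $\zeta_{0}\cdot \xi_1\cdot\ldots\cdot\xi_k$, where \begin{itemize} \item $\zeta_{0}, \xi_1, \ldots, \xi_k$ are independent random variables; \item $\zeta_0$ is (distributed as) the almost sure limit of $\deg(\emptyset, G_n)/n^{1/(1+\beta)}$ as $n\to\infty$, i.e. the limit for the root, which exists and is a nondegenerate random variable; \item $\xi_s$ has distribution $\textit{Beta}(\beta, x_s)$ for $1\leq s\leq k$. \end{itemize}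
   Context: Rooted ordered (plane) trees: vertices are labelled by finite sequences of positive integers, $\mathcal N=\bigcup_{n\ge 0}\mathbb{Z}_+^n$; the root has label $\emptyset$, and the $j$th child of the vertex $(x_1,\ldots,x_k)$ has label $(x_1,\ldots,x_k,j)$. $\deg(v,G)$ is the degree of vertex $v$ in tree $G$, and the out-degree $\deg^+(v,G)$ is its number of children. Generalized PORT model: $\beta>0$ is fixed, $G_1=\{\emptyset\}$, and at each step a new vertex is added and attached by one edge (as a new, last child) to an existing vertex $v$ of $G_n$ chosen with probability proportional to $\deg^+(v,G_n)+\beta$. (For $\beta=1$ this is the plane oriented random tree model.) *)

theory Defs
  imports "HOL-Probability.Probability" "HOL-Library.List_Lexorder"
begin

text \<open>A vertex label is a list of positive integers (the root is the empty list,
  the j-th child of v is v @ [j]). A tree is a finite set of labels.\<close>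

type_synonym tree = "nat list set"

definition outdeg :: "nat list \<Rightarrow> tree \<Rightarrow> nat" where
  "outdeg v G = card {j. v @ [j] \<in> G}"

definition deg :: "nat list \<Rightarrow> tree \<Rightarrow> nat" where
  "deg v G = outdeg v G + (if v \<noteq> [] \<and> v \<in> G then 1 else 0)"

text \<open>Given the current tree T and a number u in [0,1], select a vertex of T:
  vertices are listed in a fixed order, vertex v gets weight outdeg v T + beta,
  and the selected vertex is the first one whose cumulative weight exceeds u times
  the total weight. If u is uniform on [0,1], vertex v is chosen with probability
  proportional to outdeg v T + beta.\<close>

definition pick :: "real \<Rightarrow> tree \<Rightarrow> real \<Rightarrow> nat list" where
  "pick \<beta> T u =
    (let vs = sorted_list_of_set T;
         w = (\<lambda>i. real (outdeg (vs ! i) T) + \<beta>);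
         W = (\<Sum>i<length vs. w i);
         P = (\<lambda>i. i < length vs \<and> u * W < (\<Sum>j\<le>i. w j));
         i0 = (if \<exists>i. P i then (LEAST i. P i) else length vs - 1)
     in vs ! i0)"

definition port_step :: "real \<Rightarrow> tree \<Rightarrow> real \<Rightarrow> tree" where
  "port_step \<beta> T u = (let v = pick \<beta> T u in insert (v @ [Suc (outdeg v T)]) T)"

text \<open>port_aux beta omega m is the tree G_(m+1), driven by the uniform variables omega 0, omega 1, ...\<close>

primrec port_aux :: "real \<Rightarrow> (nat \<Rightarrow> real) \<Rightarrow> nat \<Rightarrow> tree" where
  "port_aux \<beta> \<omega> 0 = {[]}"
| "port_aux \<beta> \<omega> (Suc m) = port_step \<beta> (port_aux \<beta> \<omega> m) (\<omega> m)"

text \<open>PORT beta omega n = G_n for n >= 1 (G_1 = root only).\<close>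

definition PORT :: "real \<Rightarrow> (nat \<Rightarrow> real) \<Rightarrow> nat \<Rightarrow> tree" where
  "PORT \<beta> \<omega> n = port_aux \<beta> \<omega> (n - 1)"

definition port_space :: "(nat \<Rightarrow> real) measure" where
  "port_space = PiM UNIV (\<lambda>_. uniform_measure lborel {0..1::real})"

definition beta_measure :: "real \<Rightarrow> real \<Rightarrow> real measure" where
  "beta_measure a b = density lborel
     (\<lambda>t. ennreal (indicator {0<..<1} t * t powr (a - 1) * (1 - t) powr (b - 1) / Beta a b))"

definition nondegenerate :: "'a measure \<Rightarrow> ('a \<Rightarrow> real) \<Rightarrow> bool" where
  "nondegenerate M X \<longleftrightarrow> \<not> (\<exists>c. AE \<omega> in M. X \<omega> = c)"

end

theory Submission
  imports Defs "HOL-Real_Asymp.Real_Asymp"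
begin

text \<open>Let \<open>X\<close> be the out-degree of \<open>x\<close>. A step chooses \<open>x\<close> with probability proportional to
  \<open>X + \<beta>\<close>, so once \<open>x\<close> is present the expectation of the rising factorial
  \<open>(X + \<beta>)(X + \<beta> + 1) \<cdots> (X + \<beta> + r - 1)\<close> is multiplied in each step by the deterministic
  factor \<open>1 + r / S\<close>, where \<open>S\<close> is the total weight. For \<open>r = 1, 2\<close> this gives an
  \<open>L\<^sup>2\<close>-martingale whose increments are small enough for almost sure convergence along the times
  \<open>k\<^sup>p\<close>; monotonicity of \<open>X\<close> fills the gaps. For all \<open>r\<close> it gives the moments of the limit.

  When the vertex \<open>y\<close> gets its \<open>j\<close>-th child \<open>x\<close>, the rising factorials of \<open>y\<close> and \<open>x\<close> equal those of
  \<open>\<beta> + j\<close> and of \<open>\<beta>\<close>, and both are multiplied by the same factors from then on. Hence the \<open>r\<close>-th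
  moments of the two limits differ by the ratio of these values, which is the \<open>r\<close>-th moment of
  \<open>Beta(\<beta>, j)\<close>. The moments grow slowly enough to determine the distributions.\<close>

section \<open>Moments and convergence\<close>

text \<open>The obstacle is the random time at which a vertex x is born. Until then x has the formal
  weight \<beta> but is chosen with probability 0, so the multiplicative recursion fails for it.
  There is no conditioning on the birth time. Instead every identity is integrated against a
  function of the tree at an earlier time that vanishes unless x is present. To compare x with its
  parent y, the integrand is the combination of their rising factorials that is zero at the birth of
  x, so the indicator of presence may be moved back by one step. Trees without x contribute a
  bounded amount, which disappears in the limit because the norming tends to infinity. The limit is
  accessible only through its moments. Hence the product law is recognised by a moment problem, and
  nondegeneracy is a strict inequality between the square of the first moment and the second
  moment.\<close>

lemma char_eq_moment_series:
  assumes M: "real_distribution M"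
    and int: "\<And>r. integrable M (\<lambda>x. \<bar>x\<bar> ^ r)"
    and sm: "summable (\<lambda>r. (\<integral>x. \<bar>x\<bar> ^ r \<partial>M) * \<bar>t\<bar> ^ r / fact r)"
  shows "char M t = (\<Sum>r. (\<i> * of_real t) ^ r / fact r * of_real (\<integral>x. x ^ r \<partial>M))"
proof -
  interpret M: real_distribution M by fact
  have int': "integrable M (\<lambda>x. x ^ r)" for r
    by (rule Bochner_Integration.integrable_bound[OF int[of r]]) (auto simp: power_abs)
  define f :: "nat \<Rightarrow> real \<Rightarrow> complex"
    where "f r x = (\<i> * of_real t) ^ r / fact r * of_real (x ^ r)" for r x
  have nf: "norm (f r x) = \<bar>x\<bar> ^ r * \<bar>t\<bar> ^ r / fact r" for r x
    by (simp add: f_def norm_mult norm_divide norm_power power_abs)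
  have fi: "integrable M (f r)" for r
    unfolding f_def by (intro integrable_mult_right integrable_of_real int')
  have exp_f: "(\<lambda>r. f r x) sums iexp (t * x)" for x
    using exp_converges[of "\<i> * complex_of_real (t * x)"]
    by (simp add: f_def scaleR_conv_of_real power_mult_distrib divide_inverse mult_ac)
  have sn: "summable (\<lambda>r. norm (f r x))" for x
  proof -
    have "norm (f r x) = (\<bar>x\<bar> * \<bar>t\<bar>) ^ r /\<^sub>R fact r" for r
      by (simp add: nf power_mult_distrib divide_inverse mult.commute)
    then show ?thesis using sums_summable[OF exp_converges[of "\<bar>x\<bar> * \<bar>t\<bar>"]] by simp
  qed
  \<comment> \<open>The hypothesis \<open>sm\<close> says that the L1 norms of the terms are
    summable, which allows integration term by term.\<close>
  have "(\<integral>x. (\<Sum>r. f r x) \<partial>M) = (\<Sum>r. \<integral>x. f r x \<partial>M)"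
  proof (rule integral_suminf[OF fi])
    show "AE x in M. summable (\<lambda>r. norm (f r x))" using sn by simp
    show "summable (\<lambda>r. \<integral>x. norm (f r x) \<partial>M)"
      using sm by (simp add: nf)
  qed
  moreover have "(\<Sum>r. f r x) = iexp (t * x)" for x
    using exp_f by (rule sums_unique[symmetric])
  moreover have "(\<integral>x. f r x \<partial>M) = (\<i> * of_real t) ^ r / fact r * of_real (\<integral>x. x ^ r \<partial>M)" for r
    unfolding f_def by (subst integral_mult_right_zero) (simp add: integral_complex_of_real flip: of_real_power)
  ultimately show ?thesis unfolding char_def by simp
qed

text \<open>Equal moments make the two characteristic functions the same power series, convergent
  for every real t, and a law is determined by its characteristic function.\<close>

lemma moment_determinacy:
  assumes M: "real_distribution M" and N: "real_distribution N"
    and "\<And>r. integrable M (\<lambda>x. \<bar>x\<bar> ^ r)" "\<And>r. integrable N (\<lambda>x. \<bar>x\<bar> ^ r)"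
    and "\<And>r. (\<integral>x. \<bar>x\<bar> ^ r \<partial>M) = \<mu> r" "\<And>r. (\<integral>x. \<bar>x\<bar> ^ r \<partial>N) = \<mu> r"
    and "\<And>r. (\<integral>x. x ^ r \<partial>M) = (\<integral>x. x ^ r \<partial>N)"
    and "\<And>t. summable (\<lambda>r. \<mu> r * \<bar>t\<bar> ^ r / fact r)"
  shows "M = N"
proof (rule Levy_uniqueness[OF M N], rule ext)
  fix t show "char M t = char N t"
    using assms by (simp add: char_eq_moment_series)
qed

text \<open>Bounded second moments give uniform integrability: truncation at K changes each
  expectation by at most \<open>C / K\<close>, uniformly in n. Fatou's lemma gives the same second
  moment bound for Z, and the truncated expectations converge by dominated convergence.\<close>

lemma (in prob_space) tendsto_expectation_of_bounded_second_moment: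
  fixes Y :: "nat \<Rightarrow> 'a \<Rightarrow> real"
  assumes [measurable]: "\<And>n. Y n \<in> borel_measurable M" "Z \<in> borel_measurable M"
    and lim: "AE x in M. (\<lambda>n. Y n x) \<longlonglongrightarrow> Z x"
    and nonneg: "\<And>n x. 0 \<le> Y n x"
    and int2: "\<And>n. integrable M (\<lambda>x. (Y n x)\<^sup>2)"
    and bd: "\<And>n. expectation (\<lambda>x. (Y n x)\<^sup>2) \<le> C"
  shows "integrable M Z" and "(\<lambda>n. expectation (Y n)) \<longlonglongrightarrow> expectation Z"
proof -
  have C: "0 \<le> C" by (rule order_trans[OF integral_nonneg_AE bd[of 0]]) simp
  have Z0: "AE x in M. 0 \<le> Z x"
    using lim by eventually_elim (rule LIMSEQ_le_const, auto simp: nonneg)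
  have "(\<integral>\<^sup>+x. ennreal ((Z x)\<^sup>2) \<partial>M) = (\<integral>\<^sup>+x. liminf (\<lambda>n. ennreal ((Y n x)\<^sup>2)) \<partial>M)"
    using lim by (intro nn_integral_cong_AE, eventually_elim)
      (auto intro!: lim_imp_Liminf[symmetric] tendsto_intros)
  also have "\<dots> \<le> liminf (\<lambda>n. \<integral>\<^sup>+x. ennreal ((Y n x)\<^sup>2) \<partial>M)"
    by (rule nn_integral_liminf) simp
  also have "\<dots> \<le> ennreal C"
  proof -
    have "(\<integral>\<^sup>+x. ennreal ((Y n x)\<^sup>2) \<partial>M) \<le> ennreal C" for n
      using bd[of n] by (subst nn_integral_eq_integral[OF int2]) (auto intro: ennreal_leI)
    then show ?thesis
      by (intro Liminf_le always_eventually) auto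
  qed
  finally have ZC: "(\<integral>\<^sup>+x. ennreal ((Z x)\<^sup>2) \<partial>M) \<le> ennreal C" .
  have Z2: "integrable M (\<lambda>x. (Z x)\<^sup>2)"
    using ZC by (intro integrableI_bounded) (auto intro: le_less_trans simp: ennreal_less_top)
  have EZ2: "expectation (\<lambda>x. (Z x)\<^sup>2) \<le> C"
    using ZC C by (subst (asm) nn_integral_eq_integral[OF Z2]) auto
  have i1: "integrable M W" if "W \<in> borel_measurable M" "integrable M (\<lambda>x. (W x)\<^sup>2)" for W :: "'a \<Rightarrow> real"
    using square_integrable_imp_integrable[of W] that by simp
  show iZ: "integrable M Z" by (rule i1[OF _ Z2]) simp
  have iY: "integrable M (Y n)" for n by (rule i1[OF _ int2]) simp
  have trunc: "\<bar>expectation W - expectation (\<lambda>x. min (W x) K)\<bar> \<le> C / K"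
    if "K > 0" and W: "integrable M W" "integrable M (\<lambda>x. (W x)\<^sup>2)" "expectation (\<lambda>x. (W x)\<^sup>2) \<le> C"
      and W0: "AE x in M. 0 \<le> W x" for W :: "'a \<Rightarrow> real" and K
  proof -
    have im: "integrable M (\<lambda>x. min (W x) K)"
      using W(1) by (intro integrable_min) auto
    \<comment> \<open>Where w exceeds K, the difference is at most w, and w times K is at most the
      square of w.\<close>
    have pw: "w - min w K \<le> w\<^sup>2 / K" if "0 \<le> w" for w :: real
    proof (cases "w \<le> K")
      case False
      then have "w * K \<le> w\<^sup>2" using \<open>K > 0\<close> that by (simp add: power2_eq_square mult_left_mono)
      then show ?thesis using False \<open>K > 0\<close> zero_le_square[of K]
      by (simp add: field_simps min_def) (simp add: algebra_simps add_increasing)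
    qed (use \<open>K > 0\<close> in simp)
    have "expectation (\<lambda>x. W x - min (W x) K) \<le> expectation (\<lambda>x. (W x)\<^sup>2 / K)"
      using W0 by (intro integral_mono_AE) (auto intro!: im W pw)
    also have "\<dots> \<le> C / K" using W(3) \<open>K > 0\<close> by (simp add: divide_right_mono)
    finally have "expectation W - expectation (\<lambda>x. min (W x) K) \<le> C / K"
      by (subst (asm) Bochner_Integration.integral_diff) (auto intro: im W)
    moreover have "expectation (\<lambda>x. min (W x) K) \<le> expectation W"
      by (intro integral_mono im W) auto
    ultimately show ?thesis by simp
  qed
  show "(\<lambda>n. expectation (Y n)) \<longlonglongrightarrow> expectation Z"
  proof (rule LIMSEQ_I)
    fix e :: real assume e: "0 < e"
    \<comment> \<open>Two truncation errors and one limit error must each stay below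
      \<open>e / 3\<close>. The summand 1 keeps K positive when C is 0.\<close>
    define K where "K = 4 * (C + 1) / e"
    have K: "K > 0" "C / K < e / 3"
      using e C by (auto simp: K_def field_simps intro!: add_nonneg_pos)
    have "(\<lambda>n. expectation (\<lambda>x. min (Y n x) K)) \<longlonglongrightarrow> expectation (\<lambda>x. min (Z x) K)"
    proof (rule integral_dominated_convergence[where w="\<lambda>_. K"])
      show "AE x in M. (\<lambda>n. min (Y n x) K) \<longlonglongrightarrow> min (Z x) K"
        using lim by eventually_elim (intro tendsto_intros)
      show "AE x in M. norm (min (Y n x) K) \<le> K" for n
        using nonneg[of n] K(1) by (intro AE_I2) (simp add: abs_of_nonneg)
    qed simp_all
    then obtain n0 where n0: "\<And>n. n \<ge> n0 \<Longrightarrow>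
        \<bar>expectation (\<lambda>x. min (Y n x) K) - expectation (\<lambda>x. min (Z x) K)\<bar> < e / 3"
      using LIMSEQ_D[of _ _ "e/3"] e by (metis divide_pos_pos real_norm_def zero_less_numeral)
    show "\<exists>n0. \<forall>n\<ge>n0. norm (expectation (Y n) - expectation Z) < e"
    proof (intro exI allI impI)
      fix n assume "n \<ge> n0"
      moreover have "\<bar>expectation (Y n) - expectation (\<lambda>x. min (Y n x) K)\<bar> \<le> C / K"
        using nonneg by (intro trunc K iY int2 bd) simp
      ultimately show "norm (expectation (Y n) - expectation Z) < e"
        using n0[of n] trunc[OF K(1) iZ Z2 EZ2 Z0] K(2)
        unfolding real_norm_def by linarith
    qed
  qed
qed

lemma (in prob_space) AE_summable_of_summable_expectation:
  fixes f :: "nat \<Rightarrow> 'a \<Rightarrow> real"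
  assumes int: "\<And>k. integrable M (f k)" and nonneg: "\<And>k x. 0 \<le> f k x"
    and sm: "summable (\<lambda>k. expectation (f k))"
  shows "AE x in M. summable (\<lambda>k. f k x)"
proof -
  have [measurable]: "f k \<in> borel_measurable M" for k using int by auto
  have "(\<integral>\<^sup>+x. (\<Sum>k. ennreal (f k x)) \<partial>M) = (\<Sum>k. ennreal (expectation (f k)))"
    by (subst nn_integral_suminf) (auto intro!: suminf_cong nn_integral_eq_integral int simp: nonneg)
  also have "\<dots> \<noteq> \<infinity>"
    unfolding infinity_ennreal_def by (intro ennreal_suminf_neq_top[OF sm] Bochner_Integration.integral_nonneg nonneg)
  finally have "AE x in M. (\<Sum>k. ennreal (f k x)) \<noteq> \<infinity>"
    by (intro nn_integral_noteq_infinite) auto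
  then show ?thesis
    by eventually_elim (auto intro!: summable_suminf_not_top simp: nonneg)
qed

text \<open>For n between f k and f (Suc k), monotonicity puts \<open>u n / c n\<close> between
  \<open>u (f k) / c (f (Suc k))\<close> and \<open>u (f (Suc k)) / c (f k)\<close>. Both differ
  from a quotient on the subsequence only by a factor that tends to 1.\<close>

lemma tendsto_of_monotone_subsequence:
  fixes u c :: "nat \<Rightarrow> real" and f :: "nat \<Rightarrow> nat"
  assumes f: "strict_mono f" "f 0 = 0"
    and u: "mono u" "\<And>n. 0 \<le> u n" and c: "mono c" "\<And>n. 0 < c n"
    and ratio: "(\<lambda>k. c (f (Suc k)) / c (f k)) \<longlonglongrightarrow> 1"
    and lim: "(\<lambda>k. u (f k) / c (f k)) \<longlonglongrightarrow> L"
  shows "(\<lambda>n. u n / c n) \<longlonglongrightarrow> L"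
proof -
  \<comment> \<open>The block of n, with \<open>f (k n) \<le> n < f (Suc (k n))\<close>. In block 0
    the lower bound comes from \<open>f 0 = 0\<close>.\<close>
  define k where "k n = (LEAST k. n < f (Suc k))" for n
  have ex: "\<exists>k. n < f (Suc k)" for n
    using strict_mono_imp_increasing[OF f(1), of "Suc n"] by (intro exI[of _ n]) simp
  have k1: "n < f (Suc (k n))" for n unfolding k_def by (rule LeastI_ex[OF ex])
  have k2: "f (k n) \<le> n" for n
  proof (cases "k n")
    case (Suc i)
    then have "\<not> n < f (Suc i)" using not_less_Least[of i "\<lambda>k. n < f (Suc k)"] by (simp add: k_def)
    then show ?thesis using Suc by simp
  qed (simp add: f)
  have k_top: "filterlim k at_top sequentially"
    unfolding filterlim_at_top
  proof
    fix K show "\<forall>\<^sub>F n in sequentially. K \<le> k n"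
      using eventually_ge_at_top[of "f K"]
    proof eventually_elim
      case (elim n)
      have "f K < f (Suc (k n))" using elim k1[of n] by simp
      then show ?case using strict_mono_less[OF f(1)] by simp
    qed
  qed
  have lim': "(\<lambda>j. u (f (Suc j)) / c (f (Suc j))) \<longlonglongrightarrow> L"
    using LIMSEQ_Suc[OF lim] .
  have upper: "(\<lambda>j. u (f (Suc j)) / c (f (Suc j)) * (c (f (Suc j)) / c (f j))) \<longlonglongrightarrow> L"
    using tendsto_mult[OF lim' ratio] by simp
  have lower: "(\<lambda>j. u (f j) / c (f j) / (c (f (Suc j)) / c (f j))) \<longlonglongrightarrow> L"
    using tendsto_divide[OF lim ratio] by simp
  show ?thesis
  proof (rule tendsto_sandwich[OF _ _ filterlim_compose[OF lower k_top] filterlim_compose[OF upper k_top]])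
    show "\<forall>\<^sub>F n in sequentially. u (f (k n)) / c (f (k n)) / (c (f (Suc (k n))) / c (f (k n))) \<le> u n / c n"
    proof (intro always_eventually allI)
      fix n
      have "u (f (k n)) / c (f (Suc (k n))) \<le> u n / c n"
        using k1[of n] k2[of n] u(2) c(2) by (intro frac_le monoD[OF u(1)] monoD[OF c(1)]) auto
      then show "u (f (k n)) / c (f (k n)) / (c (f (Suc (k n))) / c (f (k n))) \<le> u n / c n"
        using c(2)[of "f (k n)"] by simp
    qed
    show "\<forall>\<^sub>F n in sequentially. u n / c n \<le>
        u (f (Suc (k n))) / c (f (Suc (k n))) * (c (f (Suc (k n))) / c (f (k n)))"
    proof (intro always_eventually allI)
      fix n
      have "u n / c n \<le> u (f (Suc (k n))) / c (f (k n))"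
        using k1[of n] k2[of n] u(2) c(2) by (intro frac_le monoD[OF u(1)] monoD[OF c(1)]) auto
      then show "u n / c n \<le> u (f (Suc (k n))) / c (f (Suc (k n))) * (c (f (Suc (k n))) / c (f (k n)))"
        using c(2)[of "f (Suc (k n))"] by simp
    qed
  qed
qed

section \<open>Moments of the limit for the root\<close>

text \<open>The r-th moment of the limit for the root: the initial rising factorial times the limit
  of the normalised growth factor.\<close>

definition moment0 :: "real \<Rightarrow> nat \<Rightarrow> real" where
  "moment0 \<beta> r = pochhammer \<beta> r * Gamma (\<beta> / (1 + \<beta>)) / Gamma ((\<beta> + real r) / (1 + \<beta>))"

lemma pos_notin_nonpos_Ints: "0 < (x :: real) \<Longrightarrow> x \<notin> \<int>\<^sub>\<le>\<^sub>0"
  by (auto elim!: nonpos_Ints_cases)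

text \<open>Logarithmic convexity of \<open>Gamma\<close> at the points \<open>y - 1 < y < y + a\<close>.\<close>

lemma Gamma_ratio_lower:
  fixes y a :: real
  assumes y: "1 < y" and a: "0 < a"
  shows "(y - 1) powr a * Gamma y \<le> Gamma (y + a)"
proof -
  define f where "f = ln \<circ> (Gamma :: real \<Rightarrow> real)"
  \<comment> \<open>The weight that makes y the convex combination of \<open>y - 1\<close> and
    \<open>y + a\<close>.\<close>
  define t where "t = 1 / (1 + a)"
  have t: "0 < t" "t < 1" using a by (auto simp: t_def)
  have ta: "t * (1 + a) = 1" using a by (simp add: t_def)
  have "(1 - t) * (y - 1) + t * (y + a) = y - 1 + t * (1 + a)" by (simp add: algebra_simps)
  then have cv: "(1 - t) * (y - 1) + t * (y + a) = y" using ta by simp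
  have "f ((1 - t) *\<^sub>R (y - 1) + t *\<^sub>R (y + a)) \<le> (1 - t) * f (y - 1) + t * f (y + a)"
    unfolding f_def using t y a by (intro convex_onD[OF log_convex_Gamma_real]) auto
  then have "f y \<le> (1 - t) * f (y - 1) + t * f (y + a)" using cv by simp
  then have "(1 + a) * f y \<le> (1 + a) * ((1 - t) * f (y - 1) + t * f (y + a))"
    using a by (intro mult_left_mono) auto
  also have "\<dots> = ((1 + a) * (1 - t)) * f (y - 1) + ((1 + a) * t) * f (y + a)"
    by (simp add: algebra_simps)
  also have "\<dots> = a * f (y - 1) + f (y + a)"
    using ta by (simp add: algebra_simps)
  finally have 1: "f y + a * (f y - f (y - 1)) \<le> f (y + a)" by (simp add: algebra_simps)
  have y0: "0 < y - 1" using y by simp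
  have "Gamma y = (y - 1) * Gamma (y - 1)" using Gamma_plus1[of "y - 1"] pos_notin_nonpos_Ints[of "y - 1"] y
    by simp
  then have "f y - f (y - 1) = ln (y - 1)"
    using y Gamma_real_pos[OF y0] by (simp add: f_def ln_mult_pos)
  with 1 have "exp (ln (Gamma y) + a * ln (y - 1)) \<le> exp (ln (Gamma (y + a)))"
    by (simp add: f_def)
  then show ?thesis
    using y a by (simp add: exp_add powr_def Gamma_real_pos mult.commute)
qed

text \<open>The quotient of consecutive terms is a bounded factor times a quotient of Gamma values
  at arguments differing by \<open>1 / (1 + \<beta>)\<close>. The latter decays like a negative
  power of r, so the ratio test succeeds for every t.\<close>

lemma summable_moment0:
  assumes \<beta>: "\<beta> > 0"
  shows "summable (\<lambda>r. moment0 \<beta> r * \<bar>t\<bar> ^ r / fact r)"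
proof -
  define a where "a = 1 / (1 + \<beta>)"
  have a: "0 < a" using \<beta> by (simp add: a_def)
  have pos: "0 < moment0 \<beta> r" for r
    using \<beta> by (auto simp: moment0_def intro!: mult_pos_pos divide_pos_pos pochhammer_pos Gamma_real_pos)
  define g where "g r = ((\<beta> + real r) / (real r + 1)) * (\<bar>t\<bar> / (((\<beta> + real r) / (1 + \<beta>) - 1) powr a))" for r
  have "g \<longlonglongrightarrow> 0" unfolding g_def using a \<beta> by real_asymp
  then have "\<forall>\<^sub>F r in sequentially. g r < 1/2" by (rule order_tendstoD) simp
  then obtain r0 where r0: "\<And>r. r \<ge> r0 \<Longrightarrow> g r < 1/2" by (auto simp: eventually_sequentially)
  show ?thesis
  \<comment> \<open>From r = 2 on the argument y below exceeds 1, as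
    \<open>Gamma_ratio_lower\<close> requires.\<close>
  proof (rule summable_ratio_test[of "1/2" "max r0 2"])
    fix r assume r: "max r0 2 \<le> r"
    define y where "y = (\<beta> + real r) / (1 + \<beta>)"
    have y: "1 < y" using r \<beta> by (simp add: y_def field_simps)
    have ya: "(\<beta> + real (Suc r)) / (1 + \<beta>) = y + a"
      by (simp add: y_def a_def field_simps add_divide_distrib)
    have G: "Gamma y > 0" "Gamma (y + a) > 0" using y a by (auto intro!: Gamma_real_pos)
    have "Gamma y / Gamma (y + a) \<le> 1 / (y - 1) powr a"
      using Gamma_ratio_lower[OF y a] G y by (simp add: field_simps)
    have G': "Gamma y \<noteq> 0" using G by simp
    have eq: "moment0 \<beta> (Suc r) * \<bar>t\<bar> ^ Suc r / fact (Suc r)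
       = ((\<beta> + real r) / (real r + 1)) * \<bar>t\<bar> * (Gamma y / Gamma (y + a)) * (moment0 \<beta> r * \<bar>t\<bar> ^ r / fact r)"
      using G' unfolding moment0_def ya y_def[symmetric] fact_Suc pochhammer_Suc power_Suc
      by (simp add: mult_ac add_ac)
    also have "\<dots> \<le> ((\<beta> + real r) / (real r + 1)) * \<bar>t\<bar> * (1 / (y - 1) powr a) * (moment0 \<beta> r * \<bar>t\<bar> ^ r / fact r)"
      using \<beta> pos[of r] by (intro mult_right_mono mult_left_mono) (auto intro!: \<open>Gamma y / Gamma (y + a) \<le> 1 / (y - 1) powr a\<close>)
    also have "\<dots> = g r * (moment0 \<beta> r * \<bar>t\<bar> ^ r / fact r)" by (simp add: g_def y_def)
    also have "\<dots> \<le> 1/2 * (moment0 \<beta> r * \<bar>t\<bar> ^ r / fact r)"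
      using r0[of r] r pos[of r] by (intro mult_right_mono) auto
    finally show "norm (moment0 \<beta> (Suc r) * \<bar>t\<bar> ^ Suc r / fact (Suc r)) \<le> 1/2 * norm (moment0 \<beta> r * \<bar>t\<bar> ^ r / fact r)"
      using pos[of r] pos[of "Suc r"] by (simp add: abs_mult del: fact_Suc power_Suc)
  qed simp
qed

text \<open>Through the reflection formula this is the nondegeneracy of the limit for the root.\<close>

lemma sin_pi_gt:
  fixes a :: real
  assumes a: "0 < a" "a < 1"
  shows "pi * a * (1 - a) < sin (pi * a)"
proof -
  \<comment> \<open>Both sides of the claim are invariant under exchanging a and 1 - a, so arguments
    up to 1/2 suffice.\<close>
  have half: "pi * b * (1 - b) < sin (pi * b)" if b: "0 < b" "b \<le> 1/2" for b :: real
  proof -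
    have "\<bar>sin (pi * b) - pi * b\<bar> \<le> inverse 6 * \<bar>pi * b\<bar> ^ 3"
      using Maclaurin_sin_bound[of "pi * b" 3]
      by (simp add: eval_nat_numeral sin_coeff_def fact_numeral)
    moreover have "inverse 6 * \<bar>pi * b\<bar> ^ 3 = (pi * b) ^ 3 / 6" using b by (simp add: abs_mult)
    ultimately have "pi * b - (pi * b) ^ 3 / 6 \<le> sin (pi * b)" by linarith
    moreover have "pi * b * (1 - b) < pi * b - (pi * b) ^ 3 / 6"
    proof -
      \<comment> \<open>The cubic error has to be smaller than \<open>pi * b * b\<close>, that is,
        \<open>pi\<^sup>2 * b < 6\<close>; for b at most 1/2 the left side is at most 5.12.\<close>
      have "pi\<^sup>2 \<le> 3.2\<^sup>2" using pi_approx by (intro power_mono) auto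
      from mult_mono[OF this b(2)] have "pi\<^sup>2 * b \<le> 3.2\<^sup>2 * (1/2)" using b by simp
      then have "pi\<^sup>2 * b / 6 < 1" by (simp add: power2_eq_square)
      then have "pi * b * b * (pi\<^sup>2 * b / 6) < pi * b * b * 1"
        using b by (intro mult_strict_left_mono) auto
      then show ?thesis by (simp add: power2_eq_square power3_eq_cube algebra_simps)
    qed
    ultimately show ?thesis by simp
  qed
  show ?thesis
  proof (cases "a \<le> 1/2")
    case False
    have "sin (pi * (1 - a)) = sin (pi * a)" by (simp add: algebra_simps sin_diff)
    then show ?thesis using half[of "1 - a"] a False by (simp add: mult_ac)
  qed (use half a in auto)
qed

text \<open>With a = 1 / (1 + \<beta>), the square of the first moment divided by the second is
  \<open>(1 - a) * Gamma (1 + a) * Gamma (1 - a)\<close>. By the reflection formula this equals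
  \<open>pi * a * (1 - a) / sin (pi * a)\<close>, which is below 1.\<close>

lemma moment0_log_convex:
  assumes \<beta>: "\<beta> > 0"
  shows "(moment0 \<beta> 1)\<^sup>2 < moment0 \<beta> 2"
proof -
  define a where "a = 1 / (1 + \<beta>)"
  have a: "0 < a" "a < 1" using \<beta> by (auto simp: a_def)
  have e: "\<beta> / (1 + \<beta>) = 1 - a" "(\<beta> + 1) / (1 + \<beta>) = 1" "(\<beta> + 2) / (1 + \<beta>) = 1 + a" "\<beta> = (1 - a) / a"
    using \<beta> by (auto simp: a_def field_simps)
  have G: "Gamma (1 + a) > 0" "Gamma (1 - a) > 0" using a by (auto intro!: Gamma_real_pos)
  have refl: "Gamma a * Gamma (1 - a) = pi / sin (pi * a)"
  proof -
    have "complex_of_real (Gamma a * Gamma (1 - a)) = of_real (pi / sin (pi * a))"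
      using Gamma_reflection_complex[of "of_real a"]
      by (simp flip: Gamma_complex_of_real sin_of_real)
    then show ?thesis by (simp only: of_real_eq_iff)
  qed
  have s: "sin (pi * a) > 0" using a by (intro sin_gt_zero) auto
  have G1: "Gamma (1 + a) = a * Gamma a"
    using Gamma_plus1[of a] pos_notin_nonpos_Ints[of a] a by (simp add: add.commute)
  have "(1 - a) * (Gamma (1 + a) * Gamma (1 - a)) = pi * a * (1 - a) / sin (pi * a)"
    using refl by (simp add: G1 field_simps)
  also have "\<dots> < 1" using sin_pi_gt[OF a] s by simp
  finally have lt: "(1 - a) * Gamma (1 - a) < 1 / Gamma (1 + a)"
    using G by (simp add: field_simps)
  have \<beta>1: "\<beta> + 1 = 1 / a" using \<beta> by (simp add: a_def field_simps)
  have m1: "moment0 \<beta> 1 = \<beta> * Gamma (1 - a)"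
    by (simp add: moment0_def e(1,2) del: e(4))
  have m2: "moment0 \<beta> 2 = \<beta> * (1 / a) * Gamma (1 - a) / Gamma (1 + a)"
    using \<beta>1 by (simp add: moment0_def e(1,3) pochhammer_Suc eval_nat_numeral)
  have "(moment0 \<beta> 1)\<^sup>2 = \<beta> * (1/a) * Gamma (1 - a) * ((1 - a) * Gamma (1 - a))"
    unfolding m1 using a e(4) by (simp add: power2_eq_square)
  also have "\<dots> < \<beta> * (1/a) * Gamma (1 - a) * (1 / Gamma (1 + a))"
    using lt \<beta> a G by (intro mult_strict_left_mono) auto
  finally show ?thesis using m2 by simp
qed

text \<open>The total weight of \<open>port_aux \<beta> \<omega> i\<close>, which has \<open>i + 1\<close> vertices, is \<open>i + (i + 1) \<beta>\<close>.\<close>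

definition growth :: "real \<Rightarrow> nat \<Rightarrow> nat \<Rightarrow> real" where
  "growth \<beta> r m = (\<Prod>i<m. 1 + real r / (real i + (real i + 1) * \<beta>))"

lemma growth_eq_pochhammer:
  assumes \<beta>: "\<beta> > 0"
  shows "growth \<beta> r m = pochhammer ((\<beta> + real r) / (1 + \<beta>)) m / pochhammer (\<beta> / (1 + \<beta>)) m"
proof -
  have "1 + real r / (real i + (real i + 1) * \<beta>)
      = ((\<beta> + real r) / (1 + \<beta>) + real i) / (\<beta> / (1 + \<beta>) + real i)" for i
  proof -
    have e: "real i + (real i + 1) * \<beta> = (1 + \<beta>) * (\<beta> / (1 + \<beta>) + real i)"
      "(\<beta> + real r) / (1 + \<beta>) + real i = (real i + (real i + 1) * \<beta> + real r) / (1 + \<beta>)"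
      using \<beta> by (auto simp: field_simps)
    have "\<beta> / (1 + \<beta>) + real i > 0" using \<beta> by (simp add: add_pos_nonneg)
    then show ?thesis unfolding e(2) using \<beta>
      by (subst e(1), subst e(1)) (simp add: add_divide_distrib)
  qed
  then show ?thesis
    by (simp add: growth_def pochhammer_prod prod_dividef lessThan_atLeast0)
qed

text \<open>The quotient of the two Gamma series, whose limits are the Gamma values, is
  \<open>growth \<beta> r (Suc n) / real n powr s\<close>. It remains to replace n by n + 2 in the
  norming, because the tree at time m has m + 1 vertices.\<close>

lemma growth_asymp:
  assumes \<beta>: "\<beta> > 0"
  shows "(\<lambda>m. growth \<beta> r m / real (Suc m) powr (real r / (1 + \<beta>)))
    \<longlonglongrightarrow> Gamma (\<beta> / (1 + \<beta>)) / Gamma ((\<beta> + real r) / (1 + \<beta>))"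
proof -
  define z w s where "z = \<beta> / (1 + \<beta>)" and "w = (\<beta> + real r) / (1 + \<beta>)" and "s = real r / (1 + \<beta>)"
  have pos: "0 < z" "0 < w" using \<beta> by (auto simp: z_def w_def)
  have w: "w = z + s" by (simp add: z_def w_def s_def add_divide_distrib)
  have s0: "0 \<le> s" using \<beta> by (simp add: s_def)
  have "Gamma w \<noteq> 0" using Gamma_real_pos[OF pos(2)] by simp
  then have "(\<lambda>n. Gamma_series z n / Gamma_series w n) \<longlonglongrightarrow> Gamma z / Gamma w"
    by (intro tendsto_divide Gamma_series_LIMSEQ)
  moreover have "\<forall>\<^sub>F n in sequentially. Gamma_series z n / Gamma_series w n = growth \<beta> r (Suc n) / real n powr s"
    using eventually_gt_at_top[of 0]
  proof eventually_elim
    case (elim n)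
    have "pochhammer z (Suc n) > 0" "pochhammer w (Suc n) > 0" using pos by (auto intro!: pochhammer_pos)
    then show ?case using elim
      by (simp add: Gamma_series_def growth_eq_pochhammer[OF \<beta>] z_def[symmetric] w_def[symmetric] w powr_def exp_add
          field_simps)
  qed
  ultimately have "(\<lambda>n. growth \<beta> r (Suc n) / real n powr s) \<longlonglongrightarrow> Gamma z / Gamma w"
    by (blast intro: Lim_transform_eventually)
  moreover have "(\<lambda>n. real n powr s / real (Suc (Suc n)) powr s) \<longlonglongrightarrow> 1"
    by real_asymp
  ultimately have "(\<lambda>n. (growth \<beta> r (Suc n) / real n powr s) * (real n powr s / real (Suc (Suc n)) powr s)) \<longlonglongrightarrow> Gamma z / Gamma w * 1"
    by (rule tendsto_mult)
  then have "(\<lambda>n. growth \<beta> r (Suc n) / real (Suc (Suc n)) powr s) \<longlonglongrightarrow> Gamma z / Gamma w"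
    unfolding mult_1_right
    by (rule Lim_transform_eventually)
       (use eventually_gt_at_top[of 0] in \<open>eventually_elim, simp\<close>)
  then show ?thesis
    by (subst (asm) filterlim_sequentially_Suc) (simp add: z_def w_def s_def)
qed

section \<open>Trees and the selection rule\<close>

text \<open>The equivalence ranges over all words v. It therefore contains closure under parents,
  the absence of gaps among siblings, and the fact that children exist only below vertices of
  T.\<close>

definition plane_tree :: "tree \<Rightarrow> bool" where
  "plane_tree T \<longleftrightarrow> finite T \<and> [] \<in> T \<and>
     (\<forall>v j. v @ [j] \<in> T \<longleftrightarrow> v \<in> T \<and> 1 \<le> j \<and> j \<le> outdeg v T)"

lemma plane_tree_children:
  "plane_tree T \<Longrightarrow> {j. v @ [j] \<in> T} = (if v \<in> T then {1..outdeg v T} else {})"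
  by (auto simp: plane_tree_def)

lemma outdeg_notin: "plane_tree T \<Longrightarrow> v \<notin> T \<Longrightarrow> outdeg v T = 0"
  unfolding outdeg_def using plane_tree_children[of T v] by simp

text \<open>The default index is that of the last vertex, so the choice stays in the tree for every
  real u. This lets the tree invariants hold for every \<omega> and not just almost surely.\<close>

lemma pick_in:
  assumes "finite T" "T \<noteq> {}"
  shows "pick \<beta> T u \<in> T"
proof -
  define vs where "vs = sorted_list_of_set T"
  have vs: "set vs = T" "vs \<noteq> []" using assms by (auto simp: vs_def)
  define P where "P i \<longleftrightarrow> i < length vs \<and> u * (\<Sum>i<length vs. real (outdeg (vs ! i) T) + \<beta>) <
    (\<Sum>j\<le>i. real (outdeg (vs ! j) T) + \<beta>)" for i
  have "(LEAST i. P i) < length vs" if "\<exists>i. P i"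
    using LeastI_ex[OF that] unfolding P_def by blast
  then have "(if \<exists>i. P i then (LEAST i. P i) else length vs - 1) < length vs"
    using vs by simp
  then show ?thesis
    unfolding pick_def Let_def vs_def[symmetric] P_def[symmetric] using vs nth_mem by blast
qed

lemma outdeg_step:
  assumes T: "plane_tree T"
  shows "outdeg w (port_step \<beta> T u) = outdeg w T + of_bool (pick \<beta> T u = w)"
proof -
  define v where "v = pick \<beta> T u"
  have v: "v \<in> T" unfolding v_def using T by (intro pick_in) (auto simp: plane_tree_def)
  have "{j. w @ [j] \<in> port_step \<beta> T u} = {j. w @ [j] \<in> T} \<union> (if v = w then {Suc (outdeg v T)} else {})"
    by (auto simp: port_step_def Let_def v_def)
  moreover have "finite {j. w @ [j] \<in> T}" by (simp add: plane_tree_children[OF T])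
  moreover have "Suc (outdeg v T) \<notin> {j. v @ [j] \<in> T}" by (simp add: plane_tree_children[OF T])
  ultimately have "card {j. w @ [j] \<in> port_step \<beta> T u} = card {j. w @ [j] \<in> T} + of_bool (v = w)"
    by (auto simp: card_insert_if)
  then show ?thesis by (simp only: outdeg_def v_def)
qed

lemma step_notin:
  assumes T: "plane_tree T"
  shows "pick \<beta> T u @ [Suc (outdeg (pick \<beta> T u) T)] \<notin> T"
  using T by (simp add: plane_tree_def)

lemma plane_tree_step:
  assumes T: "plane_tree T"
  shows "plane_tree (port_step \<beta> T u)"
proof -
  define v x where "v = pick \<beta> T u" and "x = v @ [Suc (outdeg v T)]"
  have v: "v \<in> T" unfolding v_def using T by (intro pick_in) (auto simp: plane_tree_def)
  have x: "x \<notin> T" using step_notin[OF T] by (simp add: x_def v_def)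
  have S: "port_step \<beta> T u = insert x T" by (simp add: port_step_def Let_def x_def v_def)
  have "w @ [j] \<in> insert x T \<longleftrightarrow> w \<in> insert x T \<and> 1 \<le> j \<and> j \<le> outdeg w (insert x T)" for w j
  proof -
    have o: "outdeg w (insert x T) = outdeg w T + of_bool (v = w)"
      using outdeg_step[OF T, of w \<beta> u] by (simp add: S v_def)
    have e: "w @ [j] = x \<longleftrightarrow> w = v \<and> j = Suc (outdeg v T)" by (auto simp: x_def)
    have "w @ [j] \<in> T \<longleftrightarrow> w \<in> T \<and> 1 \<le> j \<and> j \<le> outdeg w T"
      using T by (simp add: plane_tree_def)
    then show ?thesis
      using v x outdeg_notin[OF T x] unfolding insert_iff e o by auto
  qed
  then show ?thesis using T by (simp add: plane_tree_def S)
qed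

text \<open>The sum of the out-degrees counts edges, one fewer than the vertices. This makes the
  total weight a function of the time alone.\<close>

lemma port_aux_invariant:
  "plane_tree (port_aux \<beta> \<omega> m) \<and> card (port_aux \<beta> \<omega> m) = Suc m \<and>
   (\<Sum>v\<in>port_aux \<beta> \<omega> m. outdeg v (port_aux \<beta> \<omega> m)) = m"
proof (induction m)
  case 0
  have "outdeg v {[]} = 0" for v by (simp add: outdeg_def)
  then show ?case by (simp add: plane_tree_def)
next
  case (Suc m)
  define T where "T = port_aux \<beta> \<omega> m"
  define v x where "v = pick \<beta> T (\<omega> m)" and "x = v @ [Suc (outdeg v T)]"
  have T: "plane_tree T" "card T = Suc m" "(\<Sum>v\<in>T. outdeg v T) = m" using Suc by (auto simp: T_def)
  then have fin: "finite T" by (simp add: plane_tree_def)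
  have v: "v \<in> T" unfolding v_def using T by (intro pick_in) (auto simp: plane_tree_def)
  have x: "x \<notin> T" using step_notin[OF T(1)] by (simp add: x_def v_def)
  have S: "port_aux \<beta> \<omega> (Suc m) = insert x T"
    by (simp add: port_step_def Let_def x_def v_def T_def)
  have o: "outdeg w (insert x T) = outdeg w T + of_bool (v = w)" for w
    using outdeg_step[OF T(1), of w \<beta> "\<omega> m"] S by (simp add: v_def T_def)
  have "(\<Sum>w\<in>insert x T. outdeg w (insert x T)) = outdeg x T + of_bool (v = x) + (\<Sum>w\<in>T. outdeg w T + of_bool (v = w))"
    by (simp only: o sum.insert[OF fin x])
  also have "\<dots> = Suc m"
    using v x fin T(3) outdeg_notin[OF T(1) x] by (auto simp: sum.distrib of_bool_def)
  finally show ?case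
    using plane_tree_step[OF T(1), of \<beta> "\<omega> m"] S x fin T(2) by (simp add: T_def)
qed

lemmas plane_tree_port_aux = port_aux_invariant[THEN conjunct1]

lemma total_weight:
  "(\<Sum>v\<in>port_aux \<beta> \<omega> m. real (outdeg v (port_aux \<beta> \<omega> m)) + \<beta>) = real m + (real m + 1) * \<beta>"
proof -
  have "(\<Sum>v\<in>port_aux \<beta> \<omega> m. real (outdeg v (port_aux \<beta> \<omega> m))) = real m"
    using port_aux_invariant[of \<beta> \<omega> m] by (simp flip: of_nat_sum)
  then show ?thesis
    using port_aux_invariant[of \<beta> \<omega> m] by (simp add: sum.distrib add.commute)
qed

section \<open>The law of a single choice\<close>

abbreviation unif :: "real measure" where
  "unif \<equiv> uniform_measure lborel {0..1}"

lemma prob_space_unif: "prob_space unif"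
  by (rule prob_space_uniform_measure) auto

lemma measurable_pick [measurable]: "pick \<beta> T \<in> borel \<rightarrow>\<^sub>M count_space UNIV"
proof -
  define vs where "vs = sorted_list_of_set T"
  have "(\<lambda>u. if \<exists>i. i < length vs \<and> u * (\<Sum>i<length vs. real (outdeg (vs ! i) T) + \<beta>) < (\<Sum>j\<le>i. real (outdeg (vs ! j) T) + \<beta>)
     then (LEAST i. i < length vs \<and> u * (\<Sum>i<length vs. real (outdeg (vs ! i) T) + \<beta>) < (\<Sum>j\<le>i. real (outdeg (vs ! j) T) + \<beta>))
     else length vs - 1) \<in> borel \<rightarrow>\<^sub>M count_space UNIV" (is "?i \<in> _")
    by measurable
  then have "(\<lambda>u. vs ! ?i u) \<in> borel \<rightarrow>\<^sub>M count_space UNIV"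
    by (rule measurable_compose) simp
  then show ?thesis
    by (simp add: pick_def[abs_def] Let_def vs_def)
qed

text \<open>The partial sums C cut the interval from 0 to the total weight into half-open cells, and
  the scaled u lies in exactly one of them. The point u = 1 is excluded because no partial sum
  exceeds the total weight and the default index takes over there.\<close>

lemma pick_iff:
  fixes T :: tree and \<beta> :: real
  defines "vs \<equiv> sorted_list_of_set T"
  defines "C \<equiv> \<lambda>k. \<Sum>j<k. real (outdeg (vs ! j) T) + \<beta>"
  assumes T: "finite T" "T \<noteq> {}" and \<beta>: "0 < \<beta>" and i: "i < length vs" and u: "0 \<le> u" "u < 1"
  shows "pick \<beta> T u = vs ! i \<longleftrightarrow> C i \<le> u * C (length vs) \<and> u * C (length vs) < C (Suc i)"
proof -
  define P where "P k \<longleftrightarrow> k < length vs \<and> u * C (length vs) < C (Suc k)" for k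
  have mono: "mono C" unfolding C_def using \<beta> by (intro monoI sum_mono2) auto
  have C0: "C 0 = 0" by (simp add: C_def)
  have pos: "0 < C (length vs)"
    unfolding C_def using i \<beta> by (intro sum_pos) (auto intro: add_nonneg_pos)
  have "u * C (length vs) < 1 * C (length vs)" using u pos by (intro mult_strict_right_mono)
  moreover have "0 < length vs" using i by linarith
  \<comment> \<open>The last partial sum is the whole weight, so for u below 1 the default case
    never occurs.\<close>
  ultimately have "P (length vs - 1)" by (simp add: P_def)
  then have ex: "\<exists>k. P k" by blast
  define l where "l = (LEAST k. P k)"
  have Pl: "P l" unfolding l_def by (rule LeastI_ex[OF ex])
  have "pick \<beta> T u = vs ! l"
  proof -
    have "pick \<beta> T u = vs ! (if \<exists>k. P k then LEAST k. P k else length vs - 1)"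
      by (simp only: pick_def Let_def vs_def C_def P_def lessThan_Suc_atMost)
    then show ?thesis using ex by (simp add: l_def)
  qed
  moreover have "distinct vs" by (simp add: vs_def)
  ultimately have "pick \<beta> T u = vs ! i \<longleftrightarrow> l = i"
    using i Pl by (simp add: nth_eq_iff_index_eq P_def)
  also have "\<dots> \<longleftrightarrow> C i \<le> u * C (length vs) \<and> u * C (length vs) < C (Suc i)"
  proof
    assume l: "l = i"
    have "C i \<le> u * C (length vs)"
    proof (cases i)
      case (Suc k)
      then have "\<not> P k" using not_less_Least[of k P] l by (simp add: l_def)
      then show ?thesis using Suc i by (simp add: P_def)
    qed (use u pos C0 in simp)
    then show "C i \<le> u * C (length vs) \<and> u * C (length vs) < C (Suc i)"
      using Pl l by (simp add: P_def)
  next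
    assume a: "C i \<le> u * C (length vs) \<and> u * C (length vs) < C (Suc i)"
    then have "l \<le> i" unfolding l_def using i by (intro Least_le) (simp add: P_def)
    moreover have "\<not> l < i"
    proof
      assume "l < i"
      then have "C (Suc l) \<le> C i" using mono by (simp add: monoD)
      then show False using a Pl by (simp add: P_def)
    qed
    ultimately show "l = i" by simp
  qed
  finally show ?thesis .
qed

lemma prob_pick:
  assumes T: "finite T" and v: "v \<in> T" and \<beta>: "0 < \<beta>"
  shows "measure unif {u. pick \<beta> T u = v} = (real (outdeg v T) + \<beta>) / (\<Sum>w\<in>T. real (outdeg w T) + \<beta>)"
proof -
  define vs where "vs = sorted_list_of_set T"
  define C where "C k = (\<Sum>j<k. real (outdeg (vs ! j) T) + \<beta>)" for k
  have vs: "set vs = T" "distinct vs" using T by (auto simp: vs_def)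
  then obtain i where i: "i < length vs" "v = vs ! i" using v unfolding vs(1)[symmetric] in_set_conv_nth by blast
  have mono: "mono C" unfolding C_def using \<beta> by (intro monoI sum_mono2) auto
  define W where "W = C (length vs)"
  have W: "W = (\<Sum>w\<in>T. real (outdeg w T) + \<beta>)"
    unfolding W_def C_def vs(1)[symmetric] using sum.reindex_bij_betw[OF bij_betw_nth[OF vs(2) refl refl]]
    by simp
  have pos: "0 < W"
    unfolding W_def C_def using i \<beta> by (intro sum_pos) (auto intro: add_nonneg_pos)
  have bounds: "0 \<le> C i" "C i < C (Suc i)" "C (Suc i) \<le> W"
    using monoD[OF mono, of 0 i] monoD[OF mono, of "Suc i" "length vs"] i \<beta>
    by (auto simp: W_def) (auto simp: C_def add_nonneg_pos)
  have ne: "T \<noteq> {}" using v by auto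
  have pk: "pick \<beta> T u = v \<longleftrightarrow> C i / W \<le> u \<and> u < C (Suc i) / W" if "0 \<le> u" "u < 1" for u
    using pick_iff[OF T ne \<beta>, of i u] i(1) that
    unfolding vs_def[symmetric] C_def[symmetric] W_def[symmetric] i(2)
    by (simp add: pos_divide_le_eq[OF pos] pos_less_divide_eq[OF pos])
  \<comment> \<open>Without the null set {1} the event is exactly one cell, rescaled by the total
    weight W.\<close>
  have "{0..1} \<inter> {u. pick \<beta> T u = v} - {1} = {C i / W ..< C (Suc i) / W}"
  proof (intro set_eqI iffI)
    fix u assume "u \<in> {C i / W ..< C (Suc i) / W}"
    moreover have "0 \<le> C i / W" "C (Suc i) / W \<le> 1" using bounds pos by auto
    ultimately show "u \<in> {0..1} \<inter> {u. pick \<beta> T u = v} - {1}" using pk[of u] by auto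
  next
    fix u assume "u \<in> {0..1} \<inter> {u. pick \<beta> T u = v} - {1}"
    then show "u \<in> {C i / W ..< C (Suc i) / W}" using pk[of u] by (auto simp: less_le)
  qed
  moreover have ms: "{u. pick \<beta> T u = v} \<in> sets borel"
    using measurable_sets[OF measurable_pick, of "{v}" \<beta> T] by (simp add: vimage_def)
  moreover have "emeasure lborel ({0..1} \<inter> {u. pick \<beta> T u = v} - {1}) = emeasure lborel ({0..1} \<inter> {u. pick \<beta> T u = v})"
    using ms by (intro emeasure_Diff_null_set) auto
  ultimately have "emeasure lborel ({0..1} \<inter> {u. pick \<beta> T u = v}) = ennreal (C (Suc i) / W - C i / W)"
    using bounds pos by (simp add: divide_right_mono)
  then have "emeasure unif {u. pick \<beta> T u = v} = ennreal (C (Suc i) / W - C i / W)"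
    using ms by (subst emeasure_uniform_measure) (auto simp: divide_ennreal_def)
  then have "measure unif {u. pick \<beta> T u = v} = C (Suc i) / W - C i / W"
    using bounds pos by (simp add: measure_def divide_right_mono)
  also have "\<dots> = (real (outdeg v T) + \<beta>) / W"
    by (simp add: C_def i(2) diff_divide_distrib[symmetric])
  finally show ?thesis using W by simp
qed

section \<open>The tree process\<close>

interpretation unif: prob_space unif by (rule prob_space_unif)
interpretation port: sequence_space unif by unfold_locales

lemma prob_space_port_space: "prob_space port_space"
  unfolding port_space_def by (rule port.P.prob_space_axioms)

interpretation port_prob: prob_space port_space by (rule prob_space_port_space)

lemma measurable_coordinate: "(\<lambda>\<omega>. \<omega> m) \<in> port_space \<rightarrow>\<^sub>M borel"
proof -
  have "(\<lambda>\<omega>. \<omega> m) \<in> port_space \<rightarrow>\<^sub>M unif"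
    unfolding port_space_def by (rule measurable_component_singleton) simp
  then show ?thesis by (simp cong: measurable_cong_sets)
qed

text \<open>Since only finitely many trees are possible at a given time, every real function of the
  trees at two fixed times is measurable, bounded and integrable.\<close>

lemma finite_range_port_aux: "finite (range (\<lambda>\<omega>. port_aux \<beta> \<omega> m))"
proof (induction m)
  case (Suc m)
  have "range (\<lambda>\<omega>. port_aux \<beta> \<omega> (Suc m))
      \<subseteq> (\<Union>T\<in>range (\<lambda>\<omega>. port_aux \<beta> \<omega> m). (\<lambda>v. insert (v @ [Suc (outdeg v T)]) T) ` T)"
  proof safe
    fix \<omega>
    have "pick \<beta> (port_aux \<beta> \<omega> m) (\<omega> m) \<in> port_aux \<beta> \<omega> m"
      using plane_tree_port_aux[of \<beta> \<omega> m] by (intro pick_in) (auto simp: plane_tree_def)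
    then show "port_aux \<beta> \<omega> (Suc m)
      \<in> (\<Union>T\<in>range (\<lambda>\<omega>. port_aux \<beta> \<omega> m). (\<lambda>v. insert (v @ [Suc (outdeg v T)]) T) ` T)"
      by (auto simp: port_step_def Let_def)
  qed
  moreover have "finite T" if "T \<in> range (\<lambda>\<omega>. port_aux \<beta> \<omega> m)" for T
    using that plane_tree_port_aux by (auto simp: plane_tree_def)
  ultimately show ?case using Suc by (meson finite_UN_I finite_imageI finite_subset)
qed simp

text \<open>The type \<open>tree\<close> is uncountable, whereas composing over the values of a
  function requires a countable index set; the range provides one.\<close>

lemma measurable_finite_range:
  assumes "f \<in> M \<rightarrow>\<^sub>M count_space UNIV"
  shows "f \<in> M \<rightarrow>\<^sub>M count_space (range f)"
  by (rule measurable_count_space_extend[OF _ _ assms]) auto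

lemma measurable_port_aux [measurable]: "(\<lambda>\<omega>. port_aux \<beta> \<omega> m) \<in> port_space \<rightarrow>\<^sub>M count_space UNIV"
proof (induction m)
  case (Suc m)
  have "(\<lambda>u. port_step \<beta> T u) \<in> borel \<rightarrow>\<^sub>M count_space UNIV" for T
    unfolding port_step_def Let_def by (rule measurable_compose[OF measurable_pick]) simp
  then have "(\<lambda>\<omega>. port_step \<beta> T (\<omega> m)) \<in> port_space \<rightarrow>\<^sub>M count_space UNIV" for T
    by (rule measurable_compose[OF measurable_coordinate])
  then show ?case
    unfolding port_aux.simps
    by (rule measurable_compose_countable'[OF _ measurable_finite_range[OF Suc]])
       (rule countable_finite[OF finite_range_port_aux])
qed simp

lemma measurable_port_pair:
  fixes \<phi> :: "tree \<Rightarrow> tree \<Rightarrow> real"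
  shows "(\<lambda>\<omega>. \<phi> (port_aux \<beta> \<omega> m) (port_aux \<beta> \<omega> n)) \<in> borel_measurable port_space"
proof (rule measurable_compose_countable'[where f="\<lambda>T \<omega>. \<phi> T (port_aux \<beta> \<omega> n)",
      OF _ measurable_finite_range[OF measurable_port_aux] countable_finite[OF finite_range_port_aux]])
  fix T
  show "(\<lambda>\<omega>. \<phi> T (port_aux \<beta> \<omega> n)) \<in> borel_measurable port_space"
    by (rule measurable_compose[OF measurable_port_aux]) simp
qed

lemma integrable_port_pair:
  fixes \<phi> :: "tree \<Rightarrow> tree \<Rightarrow> real"
  shows "integrable port_space (\<lambda>\<omega>. \<phi> (port_aux \<beta> \<omega> m) (port_aux \<beta> \<omega> n))"
proof -
  define R where "R = (\<lambda>(T, T'). \<bar>\<phi> T T'\<bar>) ` (range (\<lambda>\<omega>. port_aux \<beta> \<omega> m) \<times> range (\<lambda>\<omega>. port_aux \<beta> \<omega> n))"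
  have "finite R" unfolding R_def by (intro finite_imageI finite_cartesian_product finite_range_port_aux)
  then have "norm (\<phi> (port_aux \<beta> \<omega> m) (port_aux \<beta> \<omega> n)) \<le> Max R" for \<omega>
    by (intro Max_ge) (auto simp: R_def)
  then show ?thesis
    by (intro port_prob.integrable_const_bound[where B="Max R"] measurable_port_pair) auto
qed

lemma integrable_port:
  fixes \<phi> :: "tree \<Rightarrow> real"
  shows "integrable port_space (\<lambda>\<omega>. \<phi> (port_aux \<beta> \<omega> n))"
  using integrable_port_pair[of "\<lambda>_. \<phi>"] .

lemma port_aux_cong: "(\<And>i. i < m \<Longrightarrow> \<omega> i = \<omega>' i) \<Longrightarrow> port_aux \<beta> \<omega> m = port_aux \<beta> \<omega>' m"
  by (induction m) auto

lemma port_aux_mono: "m \<le> n \<Longrightarrow> port_aux \<beta> \<omega> m \<subseteq> port_aux \<beta> \<omega> n"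
  by (induction rule: dec_induct) (auto simp: port_step_def Let_def)

lemma outdeg_port_aux_Suc:
  "outdeg v (port_aux \<beta> \<omega> (Suc n)) = outdeg v (port_aux \<beta> \<omega> n) + of_bool (pick \<beta> (port_aux \<beta> \<omega> n) (\<omega> n) = v)"
  by (simp add: outdeg_step plane_tree_port_aux)

text \<open>Coordinate 0 is the relevant one because \<open>comb_seq n \<omega> \<omega>'\<close>
  has the value \<open>\<omega>' 0\<close> at place n.\<close>

lemma integral_pick:
  "(\<integral>\<omega>. of_bool (pick \<beta> T (\<omega> 0) = v) \<partial>port_space) = measure unif {u. pick \<beta> T u = v}"
proof -
  have ms: "{u. pick \<beta> T u = v} \<in> sets borel"
    using measurable_sets[OF measurable_pick, of "{v}" \<beta> T] by (simp add: vimage_def)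
  have "distr port_space unif (\<lambda>\<omega>. \<omega> 0) = unif"
    unfolding port_space_def by (rule port.PiM_component) simp
  then have "measure unif {u. pick \<beta> T u = v} = (\<integral>u. indicator {u. pick \<beta> T u = v} u \<partial>distr port_space unif (\<lambda>\<omega>. \<omega> 0))"
    by simp
  also have "\<dots> = (\<integral>\<omega>. indicator {u. pick \<beta> T u = v} (\<omega> 0) \<partial>port_space)"
  proof (rule integral_distr)
    show "(\<lambda>\<omega>. \<omega> 0) \<in> port_space \<rightarrow>\<^sub>M unif"
      unfolding port_space_def by (rule measurable_component_singleton) simp
    show "(indicator {u. pick \<beta> T u = v} :: real \<Rightarrow> real) \<in> borel_measurable unif"
      by (rule borel_measurable_indicator) (use ms in simp)
  qed
  finally show ?thesis by (simp add: indicator_def of_bool_def)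
qed

text \<open>The tree at time \<open>n\<close> depends only on the first \<open>n\<close> coordinates, so gluing an independent
  sequence after them makes the \<open>n\<close>-th choice independent of it. The earlier time \<open>m\<close> lets
  \<open>\<phi>\<close> carry the past in the orthogonality argument for the increments.\<close>

lemma expectation_increment:
  fixes \<phi> :: "tree \<Rightarrow> tree \<Rightarrow> real"
  assumes \<beta>: "0 < \<beta>" and mn: "m \<le> n"
  shows "(\<integral>\<omega>. \<phi> (port_aux \<beta> \<omega> m) (port_aux \<beta> \<omega> n) *
            (real (outdeg v (port_aux \<beta> \<omega> (Suc n))) - real (outdeg v (port_aux \<beta> \<omega> n))) \<partial>port_space)
       = (\<integral>\<omega>. \<phi> (port_aux \<beta> \<omega> m) (port_aux \<beta> \<omega> n) *
            (of_bool (v \<in> port_aux \<beta> \<omega> n) * (real (outdeg v (port_aux \<beta> \<omega> n)) + \<beta>) / (real n + (real n + 1) * \<beta>)) \<partial>port_space)"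
    (is "(\<integral>\<omega>. ?l \<omega> \<partial>_) = (\<integral>\<omega>. ?r \<omega> \<partial>_)")
proof -
  interpret PP: pair_prob_space port_space port_space ..
  have comb: "(\<lambda>(\<omega>, \<omega>'). comb_seq n \<omega> \<omega>') \<in> port_space \<Otimes>\<^sub>M port_space \<rightarrow>\<^sub>M port_space"
    unfolding port_space_def by (rule measurable_comb_seq)
  have D: "distr (port_space \<Otimes>\<^sub>M port_space) port_space (\<lambda>(\<omega>, \<omega>'). comb_seq n \<omega> \<omega>') = port_space"
    unfolding port_space_def by (rule port.PiM_comb_seq)
  have l: "integrable port_space ?l"
  proof (rule port_prob.integrable_const_bound)
    define R where "R = (\<lambda>(T, T'). \<bar>\<phi> T T'\<bar>) ` (range (\<lambda>\<omega>. port_aux \<beta> \<omega> m) \<times> range (\<lambda>\<omega>. port_aux \<beta> \<omega> n))"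
    have "finite R" unfolding R_def by (intro finite_imageI finite_cartesian_product finite_range_port_aux)
    then have b: "\<bar>\<phi> (port_aux \<beta> \<omega> m) (port_aux \<beta> \<omega> n)\<bar> \<le> Max R" for \<omega>
      by (intro Max_ge) (auto simp: R_def)
    then show "AE \<omega> in port_space. norm (?l \<omega>) \<le> Max R"
      using order_trans[OF abs_ge_zero b]
      by (intro AE_I2) (simp only: outdeg_port_aux_Suc, simp add: of_bool_def)
    show "?l \<in> borel_measurable port_space"
      by (intro borel_measurable_times measurable_port_pair)
  qed
  have lc: "?l (comb_seq n \<omega> \<omega>') = \<phi> (port_aux \<beta> \<omega> m) (port_aux \<beta> \<omega> n) * of_bool (pick \<beta> (port_aux \<beta> \<omega> n) (\<omega>' 0) = v)" for \<omega> \<omega>'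
  proof -
    have "port_aux \<beta> (comb_seq n \<omega> \<omega>') k = port_aux \<beta> \<omega> k" if "k \<le> n" for k
      using that by (intro port_aux_cong) (simp add: comb_seq_def)
    moreover have "comb_seq n \<omega> \<omega>' n = \<omega>' 0" by (simp add: comb_seq_def)
    ultimately show ?thesis using mn by (simp add: outdeg_port_aux_Suc del: port_aux.simps)
  qed
  have "(\<integral>\<omega>. ?l \<omega> \<partial>port_space) = (\<integral>\<omega>. ?l \<omega> \<partial>distr (port_space \<Otimes>\<^sub>M port_space) port_space (\<lambda>(\<omega>, \<omega>'). comb_seq n \<omega> \<omega>'))"
    by (simp only: D)
  also have "\<dots> = (\<integral>p. ?l (case p of (\<omega>, \<omega>') \<Rightarrow> comb_seq n \<omega> \<omega>') \<partial>(port_space \<Otimes>\<^sub>M port_space))"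
    by (rule integral_distr[OF comb borel_measurable_integrable[OF l]])
  \<comment> \<open>By Fubini the fresh sequence is integrated first, with the trees up to time n
    held fixed.\<close>
  also have "\<dots> = (\<integral>\<omega>. (\<integral>\<omega>'. ?l (comb_seq n \<omega> \<omega>') \<partial>port_space) \<partial>port_space)"
  proof -
    have "integrable (port_space \<Otimes>\<^sub>M port_space) (\<lambda>p. ?l (case p of (\<omega>, \<omega>') \<Rightarrow> comb_seq n \<omega> \<omega>'))"
      by (rule integrable_distr[OF comb]) (simp only: D l)
    from PP.integral_fst'[OF this] show ?thesis unfolding prod.case by (rule sym)
  qed
  also have "\<dots> = (\<integral>\<omega>. ?r \<omega> \<partial>port_space)"
  proof (rule Bochner_Integration.integral_cong[OF refl])
    fix \<omega>
    define T where "T = port_aux \<beta> \<omega> n"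
    have T: "plane_tree T" unfolding T_def by (rule plane_tree_port_aux)
    have "measure unif {u. pick \<beta> T u = v} = of_bool (v \<in> T) * (real (outdeg v T) + \<beta>) / (real n + (real n + 1) * \<beta>)"
    proof (cases "v \<in> T")
      case True
      then show ?thesis
        using T \<beta> total_weight[of \<beta> \<omega> n] by (subst prob_pick) (auto simp: plane_tree_def T_def)
    next
      case False
      have "pick \<beta> T u \<in> T" for u using T by (intro pick_in) (auto simp: plane_tree_def)
      then have "{u. pick \<beta> T u = v} = {}" using False by auto
      then show ?thesis using False by simp
    qed
    then show "(\<integral>\<omega>'. ?l (comb_seq n \<omega> \<omega>') \<partial>port_space) = ?r \<omega>"
      unfolding lc by (simp add: integral_pick T_def)
  qed
  finally show ?thesis .
qed

section \<open>Rising factorials of the weight as multiplicative martingales\<close>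

lemma pochhammer_shift:
  fixes z :: real assumes "z \<noteq> 0"
  shows "pochhammer (z + 1) r = pochhammer z r + real r * pochhammer z r / z"
proof -
  have "z * pochhammer (z + 1) r = pochhammer z r * (z + real r)"
    by (simp add: pochhammer_rec[symmetric] pochhammer_Suc)
  then show ?thesis using assms by (simp add: field_simps)
qed

abbreviation wt :: "real \<Rightarrow> nat list \<Rightarrow> tree \<Rightarrow> real" where
  "wt \<beta> v T \<equiv> real (outdeg v T) + \<beta>"

text \<open>If v has weight z and is chosen, its rising factorial P grows by r * P / z. The choice
  has probability z / S, so z cancels and the expected increase is r * P / S; ordinary powers lack
  this property. The support condition on h excludes trees without v, where the choice has
  probability 0. The earlier time m allows h to depend on the past.\<close>

lemma expectation_pochhammer_Suc:
  assumes \<beta>: "0 < \<beta>" and mn: "m \<le> n" and h: "\<And>T. plane_tree T \<Longrightarrow> h T \<noteq> 0 \<Longrightarrow> v \<in> T"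
  shows "(\<integral>\<omega>. h (port_aux \<beta> \<omega> m) * pochhammer (wt \<beta> v (port_aux \<beta> \<omega> (Suc n))) r \<partial>port_space)
    = (1 + real r / (real n + (real n + 1) * \<beta>)) *
      (\<integral>\<omega>. h (port_aux \<beta> \<omega> m) * pochhammer (wt \<beta> v (port_aux \<beta> \<omega> n)) r \<partial>port_space)"
proof -
  let ?T = "\<lambda>n \<omega>. port_aux \<beta> \<omega> n"
  define \<phi> where "\<phi> T T' = h T * (real r * pochhammer (wt \<beta> v T') r / wt \<beta> v T')" for T T'
  define S where "S = real n + (real n + 1) * \<beta>"
  have pos: "0 < wt \<beta> v T" for T using \<beta> by (simp add: add_nonneg_pos)
  have i1: "integrable port_space (\<lambda>\<omega>. h (?T m \<omega>) * pochhammer (wt \<beta> v (?T n \<omega>)) r)" for n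
    by (rule integrable_port_pair)
  have e: "h (?T m \<omega>) * pochhammer (wt \<beta> v (?T (Suc n) \<omega>)) r - h (?T m \<omega>) * pochhammer (wt \<beta> v (?T n \<omega>)) r
     = \<phi> (?T m \<omega>) (?T n \<omega>) * (real (outdeg v (?T (Suc n) \<omega>)) - real (outdeg v (?T n \<omega>)))" for \<omega>
    using pochhammer_shift[of "wt \<beta> v (?T n \<omega>)" r] pos[of "?T n \<omega>"]
    by (simp add: outdeg_port_aux_Suc \<phi>_def algebra_simps of_bool_def del: port_aux.simps)
  have i2: "integrable port_space (\<lambda>\<omega>. \<phi> (?T m \<omega>) (?T n \<omega>) * (real (outdeg v (?T (Suc n) \<omega>)) - real (outdeg v (?T n \<omega>))))"
    unfolding e[symmetric] by (intro Bochner_Integration.integrable_diff i1)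
  have "(\<integral>\<omega>. h (?T m \<omega>) * pochhammer (wt \<beta> v (?T (Suc n) \<omega>)) r \<partial>port_space)
      - (\<integral>\<omega>. h (?T m \<omega>) * pochhammer (wt \<beta> v (?T n \<omega>)) r \<partial>port_space)
    = (\<integral>\<omega>. \<phi> (?T m \<omega>) (?T n \<omega>) * (real (outdeg v (?T (Suc n) \<omega>)) - real (outdeg v (?T n \<omega>))) \<partial>port_space)"
    by (subst Bochner_Integration.integral_diff[symmetric]) (auto intro!: i1 simp only: e)
  also have "\<dots> = (\<integral>\<omega>. \<phi> (?T m \<omega>) (?T n \<omega>) * (of_bool (v \<in> ?T n \<omega>) * wt \<beta> v (?T n \<omega>) / S) \<partial>port_space)"
    unfolding S_def by (rule expectation_increment[OF \<beta> mn])
  also have "\<dots> = (\<integral>\<omega>. real r / S * (h (?T m \<omega>) * pochhammer (wt \<beta> v (?T n \<omega>)) r) \<partial>port_space)"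
  proof (rule Bochner_Integration.integral_cong[OF refl])
    fix \<omega>
    have "h (?T m \<omega>) \<noteq> 0 \<Longrightarrow> v \<in> ?T n \<omega>"
      using h[OF plane_tree_port_aux] port_aux_mono[OF mn] by blast
    then show "\<phi> (?T m \<omega>) (?T n \<omega>) * (of_bool (v \<in> ?T n \<omega>) * wt \<beta> v (?T n \<omega>) / S) =
        real r / S * (h (?T m \<omega>) * pochhammer (wt \<beta> v (?T n \<omega>)) r)"
      using pos[of "?T n \<omega>"] by (cases "h (?T m \<omega>) = 0") (simp_all add: \<phi>_def)
  qed
  also have "\<dots> = real r / S * (\<integral>\<omega>. h (?T m \<omega>) * pochhammer (wt \<beta> v (?T n \<omega>)) r \<partial>port_space)"
    by simp
  finally show ?thesis unfolding S_def[symmetric] by (simp only: ring_distribs mult_1_left diff_eq_eq add.commute)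
qed

lemma growth_pos: "0 < \<beta> \<Longrightarrow> 0 < growth \<beta> r m"
  unfolding growth_def by (intro prod_pos) (auto intro!: add_pos_nonneg divide_nonneg_nonneg)

lemma growth_Suc: "growth \<beta> r (Suc m) = growth \<beta> r m * (1 + real r / (real m + (real m + 1) * \<beta>))"
  by (simp add: growth_def)

lemma expectation_pochhammer:
  assumes \<beta>: "0 < \<beta>" and mn: "m \<le> n" and h: "\<And>T. plane_tree T \<Longrightarrow> h T \<noteq> 0 \<Longrightarrow> v \<in> T"
  shows "(\<integral>\<omega>. h (port_aux \<beta> \<omega> m) * pochhammer (wt \<beta> v (port_aux \<beta> \<omega> n)) r \<partial>port_space)
    = growth \<beta> r n / growth \<beta> r m *
      (\<integral>\<omega>. h (port_aux \<beta> \<omega> m) * pochhammer (wt \<beta> v (port_aux \<beta> \<omega> m)) r \<partial>port_space)"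
  using mn
proof (induction rule: dec_induct)
  case base
  then show ?case using growth_pos[OF \<beta>, of r m] by simp
next
  case (step n)
  then show ?case
    using expectation_pochhammer_Suc[OF \<beta> step.hyps(1) h] by (simp add: growth_Suc mult_ac)
qed

section \<open>Limits of the moments\<close>

text \<open>The moments of the target law: each list entry j contributes the r-th moment of
  Beta(\<beta>, j).\<close>

definition moment :: "real \<Rightarrow> nat list \<Rightarrow> nat \<Rightarrow> real" where
  "moment \<beta> x r = moment0 \<beta> r * (\<Prod>j\<leftarrow>x. pochhammer \<beta> r / pochhammer (\<beta> + real j) r)"

text \<open>The successor appears because \<open>port_aux \<beta> \<omega> n\<close> has n + 1
  vertices.\<close>

abbreviation norml :: "real \<Rightarrow> nat \<Rightarrow> real" where
  "norml \<beta> n \<equiv> real (Suc n) powr (1 / (1 + \<beta>))"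

lemma norml_power: "norml \<beta> n ^ r = real (Suc n) powr (real r / (1 + \<beta>))"
  by (subst powr_power) (simp_all del: of_nat_Suc)

lemma norml_at_top:
  assumes "0 < \<beta>"
  shows "filterlim (\<lambda>n. norml \<beta> n) at_top sequentially"
  using assms by real_asymp

lemma wt_pos: "0 < \<beta> \<Longrightarrow> 0 < wt \<beta> v T"
  by (simp add: add_nonneg_pos)

lemma expectation_pochhammer_root:
  assumes "0 < \<beta>"
  shows "(\<integral>\<omega>. pochhammer (wt \<beta> [] (port_aux \<beta> \<omega> n)) r \<partial>port_space) = growth \<beta> r n * pochhammer \<beta> r"
proof -
  have "outdeg [] {[]} = 0" by (simp add: outdeg_def)
  then show ?thesis
    using expectation_pochhammer[OF assms, of 0 n "\<lambda>_. 1" "[]" r]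
    by (simp add: plane_tree_def growth_def port_prob.prob_space)
qed

lemma moment_limit_root:
  assumes \<beta>: "0 < \<beta>"
  shows "(\<lambda>n. (\<integral>\<omega>. pochhammer (wt \<beta> [] (port_aux \<beta> \<omega> n)) r \<partial>port_space) / norml \<beta> n ^ r)
    \<longlonglongrightarrow> moment0 \<beta> r"
  unfolding norml_power expectation_pochhammer_root[OF \<beta>]
  using tendsto_mult_right[OF growth_asymp[OF \<beta>, of r], of "pochhammer \<beta> r"]
  by (simp add: moment0_def mult_ac del: of_nat_Suc)

lemma child_mem_iff:
  assumes "plane_tree T" "0 < j"
  shows "y @ [j] \<in> T \<longleftrightarrow> j \<le> outdeg y T"
  using assms outdeg_notin[of T y] by (cases "y \<in> T") (auto simp: plane_tree_def)

text \<open>The bracket vanishes at the moment \<open>x\<close> is born, and its conditional expectation is multiplied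
  by a constant in each later step.\<close>

lemma child_compensation:
  fixes r j :: nat and y :: "nat list"
  assumes \<beta>: "0 < \<beta>" and j: "0 < j"
  defines "c0 \<equiv> pochhammer \<beta> r" and "c1 \<equiv> pochhammer (\<beta> + real j) r" and "x \<equiv> y @ [j]"
  shows "(\<integral>\<omega>. of_bool (x \<in> port_aux \<beta> \<omega> n) *
      (c1 * pochhammer (wt \<beta> x (port_aux \<beta> \<omega> n)) r - c0 * pochhammer (wt \<beta> y (port_aux \<beta> \<omega> n)) r) \<partial>port_space) = 0"
proof (induction n)
  case 0
  show ?case by (simp add: x_def)
next
  case (Suc n)
  let ?T = "\<lambda>n \<omega>. port_aux \<beta> \<omega> n"
  let ?h = "\<lambda>T. of_bool (x \<in> T) :: real"
  let ?\<Psi> = "\<lambda>T. c1 * pochhammer (wt \<beta> x T) r - c0 * pochhammer (wt \<beta> y T) r"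
  have i: "integrable port_space (\<lambda>\<omega>. ?h (?T m \<omega>) * pochhammer (wt \<beta> v (?T n \<omega>)) r)" for v m n
    by (rule integrable_port_pair)
  have split: "(\<integral>\<omega>. ?h (?T m \<omega>) * ?\<Psi> (?T n \<omega>) \<partial>port_space)
     = c1 * (\<integral>\<omega>. ?h (?T m \<omega>) * pochhammer (wt \<beta> x (?T n \<omega>)) r \<partial>port_space)
     - c0 * (\<integral>\<omega>. ?h (?T m \<omega>) * pochhammer (wt \<beta> y (?T n \<omega>)) r \<partial>port_space)" for m n
  proof -
    have "(\<integral>\<omega>. ?h (?T m \<omega>) * ?\<Psi> (?T n \<omega>) \<partial>port_space) = (\<integral>\<omega>. c1 * (?h (?T m \<omega>) * pochhammer (wt \<beta> x (?T n \<omega>)) r)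
        - c0 * (?h (?T m \<omega>) * pochhammer (wt \<beta> y (?T n \<omega>)) r) \<partial>port_space)"
      by (intro Bochner_Integration.integral_cong) (auto simp: algebra_simps)
    also have "\<dots> = c1 * (\<integral>\<omega>. ?h (?T m \<omega>) * pochhammer (wt \<beta> x (?T n \<omega>)) r \<partial>port_space)
     - c0 * (\<integral>\<omega>. ?h (?T m \<omega>) * pochhammer (wt \<beta> y (?T n \<omega>)) r \<partial>port_space)"
      by (subst Bochner_Integration.integral_diff) (auto intro!: integrable_mult_right i)
    finally show ?thesis .
  qed
  have hx: "plane_tree T \<Longrightarrow> ?h T \<noteq> 0 \<Longrightarrow> x \<in> T" for T by simp
  have hy: "plane_tree T \<Longrightarrow> ?h T \<noteq> 0 \<Longrightarrow> y \<in> T" for T by (auto simp: x_def plane_tree_def)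
  \<comment> \<open>At its birth x has weight \<beta> and y has weight \<beta> + j, so the bracket
    is \<open>c1 * c0 - c0 * c1\<close>. The indicator may thus be taken at time n, where the
    one-step recursion applies.\<close>
  have new: "?h (?T (Suc n) \<omega>) * ?\<Psi> (?T (Suc n) \<omega>) = ?h (?T n \<omega>) * ?\<Psi> (?T (Suc n) \<omega>)" for \<omega>
  proof (cases "x \<in> ?T (Suc n) \<omega> \<and> x \<notin> ?T n \<omega>")
    case True
    have pick: "pick \<beta> (?T n \<omega>) (\<omega> n) \<in> ?T n \<omega>"
      using plane_tree_port_aux[of \<beta> \<omega> n] by (intro pick_in) (auto simp: plane_tree_def)
    have "outdeg x (?T (Suc n) \<omega>) = 0"
      using True pick outdeg_notin[OF plane_tree_port_aux] unfolding outdeg_port_aux_Suc by auto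
    moreover have "outdeg y (?T (Suc n) \<omega>) = j"
      using True child_mem_iff[OF plane_tree_port_aux j, of y \<beta> \<omega>] outdeg_port_aux_Suc[of y \<beta> \<omega> n]
      unfolding x_def by (auto split: if_splits simp: of_bool_def simp del: port_aux.simps)
    ultimately have "?\<Psi> (?T (Suc n) \<omega>) = 0" by (simp add: c0_def c1_def add.commute del: port_aux.simps)
    then show ?thesis by simp
  next
    case False
    then show ?thesis using port_aux_mono[of n "Suc n" \<beta> \<omega>] by auto
  qed
  have sx: "(\<integral>\<omega>. ?h (?T n \<omega>) * pochhammer (wt \<beta> x (?T (Suc n) \<omega>)) r \<partial>port_space)
      = (1 + real r / (real n + (real n + 1) * \<beta>)) * (\<integral>\<omega>. ?h (?T n \<omega>) * pochhammer (wt \<beta> x (?T n \<omega>)) r \<partial>port_space)"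
    by (rule expectation_pochhammer_Suc[of \<beta> n n ?h x r, OF \<beta> order_refl hx])
  have sy: "(\<integral>\<omega>. ?h (?T n \<omega>) * pochhammer (wt \<beta> y (?T (Suc n) \<omega>)) r \<partial>port_space)
      = (1 + real r / (real n + (real n + 1) * \<beta>)) * (\<integral>\<omega>. ?h (?T n \<omega>) * pochhammer (wt \<beta> y (?T n \<omega>)) r \<partial>port_space)"
    by (rule expectation_pochhammer_Suc[of \<beta> n n ?h y r, OF \<beta> order_refl hy])
  have "(\<integral>\<omega>. ?h (?T (Suc n) \<omega>) * ?\<Psi> (?T (Suc n) \<omega>) \<partial>port_space) = (1 + real r / (real n + (real n + 1) * \<beta>)) *
      (\<integral>\<omega>. ?h (?T n \<omega>) * ?\<Psi> (?T n \<omega>) \<partial>port_space)"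
    unfolding new unfolding split sx sy
    by (simp only: sx sy right_diff_distrib mult.left_commute)
  then show ?case using Suc by simp
qed

text \<open>By \<open>child_compensation\<close> only trees without x contribute to
  \<open>c1 * ?E x n - c0 * ?E y n\<close>. There x has no child and y has fewer than j, so the
  contribution is at most \<open>c0 * c1\<close> in absolute value, and dividing by the norming
  makes it vanish.\<close>

lemma moment_limit:
  assumes \<beta>: "0 < \<beta>" and x: "\<forall>j\<in>set x. 0 < j"
  shows "(\<lambda>n. (\<integral>\<omega>. pochhammer (wt \<beta> x (port_aux \<beta> \<omega> n)) r \<partial>port_space) / norml \<beta> n ^ r)
    \<longlonglongrightarrow> moment \<beta> x r"
  using x
proof (induction x rule: rev_induct)
  case Nil
  then show ?case using moment_limit_root[OF \<beta>] by (simp add: moment_def)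
next
  case (snoc j y)
  let ?T = "\<lambda>n \<omega>. port_aux \<beta> \<omega> n"
  let ?E = "\<lambda>v n. \<integral>\<omega>. pochhammer (wt \<beta> v (?T n \<omega>)) r \<partial>port_space"
  define x where "x = y @ [j]"
  define c0 c1 where "c0 = pochhammer \<beta> r" and "c1 = pochhammer (\<beta> + real j) r"
  have j: "0 < j" using snoc.prems by simp
  have c: "0 < c0" "0 < c1" using \<beta> by (auto simp: c0_def c1_def intro!: pochhammer_pos add_pos_nonneg)
  have IH: "(\<lambda>n. ?E y n / norml \<beta> n ^ r) \<longlonglongrightarrow> moment \<beta> y r" using snoc by simp
  have mx: "moment \<beta> x r = c0 / c1 * moment \<beta> y r" by (simp add: x_def moment_def c0_def c1_def)
  show ?case
  \<comment> \<open>For r = 0 the norming is constantly 1 and cannot absorb the error, but then both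
    expectations are 1.\<close>
  proof (cases "r = 0")
    case True
    then show ?thesis using IH mx by (simp add: x_def c0_def c1_def port_prob.prob_space)
  next
    case False
    have nonneg: "0 \<le> pochhammer (wt \<beta> v T) r" for v T
      using wt_pos[OF \<beta>, of v T] by (intro less_imp_le pochhammer_pos)
    have bd: "\<bar>c1 * ?E x n - c0 * ?E y n\<bar> \<le> c0 * c1" for n
    proof -
      let ?\<Psi> = "\<lambda>T. c1 * pochhammer (wt \<beta> x T) r - c0 * pochhammer (wt \<beta> y T) r"
      have i: "integrable port_space (\<lambda>\<omega>. \<phi> (?T n \<omega>))" for \<phi> :: "tree \<Rightarrow> real" by (rule integrable_port)
      have "c1 * ?E x n - c0 * ?E y n = (\<integral>\<omega>. ?\<Psi> (?T n \<omega>) \<partial>port_space)"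
        by (subst Bochner_Integration.integral_diff) (auto intro!: i)
      also have "\<dots> = (\<integral>\<omega>. of_bool (x \<in> ?T n \<omega>) * ?\<Psi> (?T n \<omega>) + of_bool (x \<notin> ?T n \<omega>) * ?\<Psi> (?T n \<omega>) \<partial>port_space)"
        by (intro Bochner_Integration.integral_cong) auto
      also have "\<dots> = (\<integral>\<omega>. of_bool (x \<in> ?T n \<omega>) * ?\<Psi> (?T n \<omega>) \<partial>port_space)
          + (\<integral>\<omega>. of_bool (x \<notin> ?T n \<omega>) * ?\<Psi> (?T n \<omega>) \<partial>port_space)"
        by (rule Bochner_Integration.integral_add) (rule i)+
      also have "(\<integral>\<omega>. of_bool (x \<in> ?T n \<omega>) * ?\<Psi> (?T n \<omega>) \<partial>port_space) = 0"
        unfolding c0_def c1_def x_def by (rule child_compensation[OF \<beta> j])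
      finally have eq: "c1 * ?E x n - c0 * ?E y n = (\<integral>\<omega>. of_bool (x \<notin> ?T n \<omega>) * ?\<Psi> (?T n \<omega>) \<partial>port_space)" by simp
      have pw: "\<bar>of_bool (x \<notin> ?T n \<omega>) * ?\<Psi> (?T n \<omega>)\<bar> \<le> c0 * c1" for \<omega>
      proof (cases "x \<in> ?T n \<omega>")
        case False
        have "outdeg x (?T n \<omega>) = 0" using False by (rule outdeg_notin[OF plane_tree_port_aux])
        moreover have "outdeg y (?T n \<omega>) < j"
          using False child_mem_iff[OF plane_tree_port_aux j] by (simp add: x_def)
        then have "pochhammer (wt \<beta> y (?T n \<omega>)) r \<le> c1"
          unfolding c1_def pochhammer_prod using \<beta> by (intro prod_mono) auto
        then have "c0 * pochhammer (wt \<beta> y (?T n \<omega>)) r \<le> c0 * c1" using c by simp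
        moreover have "0 \<le> c0 * pochhammer (wt \<beta> y (?T n \<omega>)) r" using c nonneg by simp
        ultimately show ?thesis using False by (simp add: c0_def[symmetric] abs_le_iff mult.commute)
      qed (use c in simp)
      have "\<bar>\<integral>\<omega>. of_bool (x \<notin> ?T n \<omega>) * ?\<Psi> (?T n \<omega>) \<partial>port_space\<bar>
          \<le> (\<integral>\<omega>. \<bar>of_bool (x \<notin> ?T n \<omega>) * ?\<Psi> (?T n \<omega>)\<bar> \<partial>port_space)"
        by (rule integral_abs_bound)
      also have "\<dots> \<le> (\<integral>\<omega>. c0 * c1 \<partial>port_space)"
        by (rule integral_mono[OF i]) (use pw in auto)
      finally show ?thesis unfolding eq by (simp add: port_prob.prob_space)
    qed
    have "filterlim (\<lambda>n. norml \<beta> n ^ r) at_top sequentially"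
      using False by (intro filterlim_pow_at_top norml_at_top[OF \<beta>]) simp
    then have "(\<lambda>n. c0 * c1 / norml \<beta> n ^ r) \<longlonglongrightarrow> 0"
      by (intro real_tendsto_divide_at_top[OF tendsto_const])
    then have "(\<lambda>n. (c1 * ?E x n - c0 * ?E y n) / norml \<beta> n ^ r) \<longlonglongrightarrow> 0"
    proof (rule Lim_null_comparison[rotated], intro always_eventually allI)
      fix n show "norm ((c1 * ?E x n - c0 * ?E y n) / norml \<beta> n ^ r) \<le> c0 * c1 / norml \<beta> n ^ r"
        using bd[of n] by (simp add: divide_right_mono del: of_nat_Suc)
    qed
    then have "(\<lambda>n. ((c1 * ?E x n - c0 * ?E y n) / norml \<beta> n ^ r + c0 * (?E y n / norml \<beta> n ^ r)) / c1)
        \<longlonglongrightarrow> (0 + c0 * moment \<beta> y r) / c1"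
      using c by (intro tendsto_intros IH) auto
    moreover have "((c1 * ?E x n - c0 * ?E y n) / norml \<beta> n ^ r + c0 * (?E y n / norml \<beta> n ^ r)) / c1 = ?E x n / norml \<beta> n ^ r" for n
      using c by (simp add: diff_divide_distrib del: of_nat_Suc)
    ultimately show ?thesis unfolding x_def[symmetric] by (simp add: mx)
  qed
qed

section \<open>Almost sure convergence\<close>

lemma growth_over_norml:
  assumes \<beta>: "0 < \<beta>"
  obtains C where "0 < C" "(\<lambda>n. growth \<beta> 1 n / norml \<beta> n) \<longlonglongrightarrow> C"
proof
  show "0 < Gamma (\<beta> / (1 + \<beta>)) / Gamma ((\<beta> + real 1) / (1 + \<beta>))"
    using \<beta> by (intro divide_pos_pos Gamma_real_pos) auto
  show "(\<lambda>n. growth \<beta> 1 n / norml \<beta> n) \<longlonglongrightarrow> Gamma (\<beta> / (1 + \<beta>)) / Gamma ((\<beta> + real 1) / (1 + \<beta>))"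
    using growth_asymp[OF \<beta>, of 1] by simp
qed

lemma norml_pos: "0 < norml \<beta> n"
  by simp

lemma norml_le_growth:
  assumes \<beta>: "0 < \<beta>"
  obtains B where "0 < B" "\<And>n. norml \<beta> n \<le> B * growth \<beta> 1 n"
proof -
  obtain C where C: "0 < C" "(\<lambda>n. growth \<beta> 1 n / norml \<beta> n) \<longlonglongrightarrow> C"
    using growth_over_norml[OF \<beta>] by blast
  have "(\<lambda>n. inverse (growth \<beta> 1 n / norml \<beta> n)) \<longlonglongrightarrow> inverse C"
    using C by (intro tendsto_inverse) auto
  then have "Bseq (\<lambda>n. inverse (growth \<beta> 1 n / norml \<beta> n))"
    by (intro convergent_imp_Bseq convergentI)
  then obtain B where B: "0 < B" "\<And>n. norm (inverse (growth \<beta> 1 n / norml \<beta> n)) \<le> B"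
    by (auto elim: BseqE)
  have "norml \<beta> n \<le> B * growth \<beta> 1 n" for n
  proof -
    have "norml \<beta> n / growth \<beta> 1 n \<le> B"
      using B(2)[of n] by (simp only: inverse_divide real_norm_def abs_le_iff)
    then show ?thesis using growth_pos[OF \<beta>, of 1 n] by (simp add: divide_le_eq)
  qed
  with B(1) show ?thesis by (rule that)
qed

lemma first_moment_bound:
  assumes \<beta>: "0 < \<beta>" and x: "\<forall>j\<in>set x. 0 < j"
  obtains K where "0 < K" "\<And>n. (\<integral>\<omega>. wt \<beta> x (port_aux \<beta> \<omega> n) \<partial>port_space) \<le> K * growth \<beta> 1 n"
proof -
  let ?E = "\<lambda>n. \<integral>\<omega>. wt \<beta> x (port_aux \<beta> \<omega> n) \<partial>port_space"
  obtain C where C: "0 < C" "(\<lambda>n. growth \<beta> 1 n / norml \<beta> n) \<longlonglongrightarrow> C"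
    using growth_over_norml[OF \<beta>] by blast
  have "(\<lambda>n. ?E n / norml \<beta> n) \<longlonglongrightarrow> moment \<beta> x 1"
    using moment_limit[OF \<beta> x, of 1] by simp
  then have "(\<lambda>n. (?E n / norml \<beta> n) / (growth \<beta> 1 n / norml \<beta> n)) \<longlonglongrightarrow> moment \<beta> x 1 / C"
    using C by (intro tendsto_divide) auto
  then have "Bseq (\<lambda>n. (?E n / norml \<beta> n) / (growth \<beta> 1 n / norml \<beta> n))"
    by (intro convergent_imp_Bseq convergentI)
  then obtain K where K: "0 < K" "\<And>n. norm ((?E n / norml \<beta> n) / (growth \<beta> 1 n / norml \<beta> n)) \<le> K"
    by (auto elim: BseqE)
  have "?E n \<le> K * growth \<beta> 1 n" for n
  proof -
    have "(?E n / norml \<beta> n) / (growth \<beta> 1 n / norml \<beta> n) = ?E n / growth \<beta> 1 n"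
      using norml_pos[of n \<beta>] by simp
    then have "?E n / growth \<beta> 1 n \<le> K" using K(2)[of n] by (simp only: real_norm_def abs_le_iff)
    then show ?thesis using growth_pos[OF \<beta>, of 1 n] by (simp add: divide_le_eq)
  qed
  with K(1) show ?thesis by (rule that)
qed

text \<open>Factor by factor this is 1 + 2 s \<le> (1 + s)^2. It makes the quadratic terms cancel in
  the bound for the martingale increments.\<close>

lemma growth_2_le:
  assumes \<beta>: "0 < \<beta>" and mn: "m \<le> n"
  shows "growth \<beta> 2 n / growth \<beta> 2 m \<le> (growth \<beta> 1 n / growth \<beta> 1 m)\<^sup>2"
  using mn
proof (induction rule: dec_induct)
  case base
  then show ?case using growth_pos[OF \<beta>, of 2 m] growth_pos[OF \<beta>, of 1 m] by simp
next
  case (step n)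
  define s where "s = 1 / (real n + (real n + 1) * \<beta>)"
  have s: "0 \<le> s" using \<beta> by (simp add: s_def)
  have "1 + 2 * s \<le> (1 + s)\<^sup>2" by (simp add: power2_eq_square algebra_simps)
  then have "growth \<beta> 2 n / growth \<beta> 2 m * (1 + 2 * s) \<le> (growth \<beta> 1 n / growth \<beta> 1 m)\<^sup>2 * (1 + s)\<^sup>2"
    using step.IH s by (intro mult_mono) auto
  moreover have "growth \<beta> 2 (Suc n) = growth \<beta> 2 n * (1 + 2 * s)" "growth \<beta> 1 (Suc n) = growth \<beta> 1 n * (1 + s)"
    by (simp_all add: growth_Suc s_def)
  ultimately show ?case by (simp add: power_mult_distrib power_divide)
qed

text \<open>Expand the square. The mixed term follows from the recursion for r = 1, the square at
  time n from that for r = 2 through w^2 = w (w + 1) - w. What remains is of first order in the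
  weight and does not depend on n.\<close>

lemma increment_second_moment:
  assumes \<beta>: "0 < \<beta>" and mn: "m \<le> n"
  shows "(\<integral>\<omega>. of_bool (x \<in> port_aux \<beta> \<omega> m) *
      (wt \<beta> x (port_aux \<beta> \<omega> n) / growth \<beta> 1 n - wt \<beta> x (port_aux \<beta> \<omega> m) / growth \<beta> 1 m)\<^sup>2 \<partial>port_space)
    \<le> (\<integral>\<omega>. wt \<beta> x (port_aux \<beta> \<omega> m) \<partial>port_space) / (growth \<beta> 1 m)\<^sup>2"
proof -
  let ?T = "\<lambda>n \<omega>. port_aux \<beta> \<omega> n"
  define c g where "c = growth \<beta> 1" and "g = growth \<beta> 2"
  define h1 :: "tree \<Rightarrow> real" where "h1 T = of_bool (x \<in> T)" for T
  \<comment> \<open>The past weight inside the test function turns the mixed term of the square into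
    an instance of the first-order recursion.\<close>
  define h2 where "h2 T = h1 T * wt \<beta> x T" for T
  define a1 where "a1 = (\<integral>\<omega>. h1 (?T m \<omega>) * wt \<beta> x (?T m \<omega>) \<partial>port_space)"
  define a2 where "a2 = (\<integral>\<omega>. h1 (?T m \<omega>) * (wt \<beta> x (?T m \<omega>))\<^sup>2 \<partial>port_space)"
  have pos: "0 < c k" "0 < g k" for k using growth_pos[OF \<beta>] by (auto simp: c_def g_def)
  have p2: "pochhammer w 2 = w\<^sup>2 + w" for w :: real
    by (simp add: eval_nat_numeral pochhammer_Suc algebra_simps)
  have i: "integrable port_space (\<lambda>\<omega>. \<phi> (?T m \<omega>) (?T n \<omega>))" for \<phi> :: "tree \<Rightarrow> tree \<Rightarrow> real"
    by (rule integrable_port_pair)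
  have e11: "(\<integral>\<omega>. h1 (?T m \<omega>) * wt \<beta> x (?T n \<omega>) \<partial>port_space) = c n / c m * a1"
    using expectation_pochhammer[OF \<beta> mn, of h1 x 1] by (simp add: h1_def a1_def c_def)
  have e21: "(\<integral>\<omega>. h2 (?T m \<omega>) * wt \<beta> x (?T n \<omega>) \<partial>port_space) = c n / c m * a2"
    using expectation_pochhammer[OF \<beta> mn, of h2 x 1]
    by (simp add: h2_def h1_def a2_def c_def power2_eq_square mult_ac)
  have "(\<integral>\<omega>. h1 (?T m \<omega>) * pochhammer (wt \<beta> x (?T n \<omega>)) 2 \<partial>port_space)
      = g n / g m * (\<integral>\<omega>. h1 (?T m \<omega>) * pochhammer (wt \<beta> x (?T m \<omega>)) 2 \<partial>port_space)"
    using expectation_pochhammer[OF \<beta> mn, of h1 x 2] by (simp add: h1_def g_def)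
  also have "(\<integral>\<omega>. h1 (?T m \<omega>) * pochhammer (wt \<beta> x (?T m \<omega>)) 2 \<partial>port_space) = a2 + a1"
    unfolding p2 distrib_left a1_def a2_def
    by (rule Bochner_Integration.integral_add) (rule integrable_port)+
  also have "(\<integral>\<omega>. h1 (?T m \<omega>) * pochhammer (wt \<beta> x (?T n \<omega>)) 2 \<partial>port_space)
      = (\<integral>\<omega>. h1 (?T m \<omega>) * (wt \<beta> x (?T n \<omega>))\<^sup>2 \<partial>port_space) + c n / c m * a1"
    unfolding p2 distrib_left e11[symmetric]
    by (rule Bochner_Integration.integral_add) (rule i)+
  finally have e12: "(\<integral>\<omega>. h1 (?T m \<omega>) * (wt \<beta> x (?T n \<omega>))\<^sup>2 \<partial>port_space) = g n / g m * (a2 + a1) - c n / c m * a1"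
    by simp
  have a0: "0 \<le> a1" "0 \<le> a2"
    unfolding a1_def a2_def using \<beta> by (auto simp: h1_def intro!: Bochner_Integration.integral_nonneg)
  have "(\<integral>\<omega>. h1 (?T m \<omega>) * (wt \<beta> x (?T n \<omega>) / c n - wt \<beta> x (?T m \<omega>) / c m)\<^sup>2 \<partial>port_space)
     = (\<integral>\<omega>. (h1 (?T m \<omega>) * (wt \<beta> x (?T n \<omega>))\<^sup>2) / (c n)\<^sup>2 - 2 / (c n * c m) * (h2 (?T m \<omega>) * wt \<beta> x (?T n \<omega>))
        + (h1 (?T m \<omega>) * (wt \<beta> x (?T m \<omega>))\<^sup>2) / (c m)\<^sup>2 \<partial>port_space)"
  proof (rule Bochner_Integration.integral_cong[OF refl])
    fix \<omega>
    have "h * (u / a - v / b)\<^sup>2 = h * u\<^sup>2 / a\<^sup>2 - 2 / (a * b) * (h * v * u) + h * v\<^sup>2 / b\<^sup>2" for h u v a b :: real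
      by (simp add: power2_diff power_divide right_diff_distrib distrib_left mult_ac)
    then show "h1 (?T m \<omega>) * (wt \<beta> x (?T n \<omega>) / c n - wt \<beta> x (?T m \<omega>) / c m)\<^sup>2
      = (h1 (?T m \<omega>) * (wt \<beta> x (?T n \<omega>))\<^sup>2) / (c n)\<^sup>2 - 2 / (c n * c m) * (h2 (?T m \<omega>) * wt \<beta> x (?T n \<omega>))
        + (h1 (?T m \<omega>) * (wt \<beta> x (?T m \<omega>))\<^sup>2) / (c m)\<^sup>2"
      unfolding h2_def .
  qed
  also have "\<dots> = (\<integral>\<omega>. (h1 (?T m \<omega>) * (wt \<beta> x (?T n \<omega>))\<^sup>2) / (c n)\<^sup>2 \<partial>port_space)
      - (\<integral>\<omega>. 2 / (c n * c m) * (h2 (?T m \<omega>) * wt \<beta> x (?T n \<omega>)) \<partial>port_space)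
      + (\<integral>\<omega>. (h1 (?T m \<omega>) * (wt \<beta> x (?T m \<omega>))\<^sup>2) / (c m)\<^sup>2 \<partial>port_space)"
    by (subst Bochner_Integration.integral_add, rule i, rule i,
        subst Bochner_Integration.integral_diff, rule i, rule i, rule refl)
  also have "\<dots> = (g n / g m * (a2 + a1) - c n / c m * a1) / (c n)\<^sup>2 - 2 / (c n * c m) * (c n / c m * a2) + a2 / (c m)\<^sup>2"
    unfolding integral_divide_zero integral_mult_right_zero e12 e21 a2_def[symmetric] by (rule refl)
  also have "\<dots> = (g n / g m) / (c n)\<^sup>2 * (a2 + a1) - a1 / (c n * c m) - a2 / (c m)\<^sup>2"
  proof -
    have "(q * (a2 + a1) - u / v * a1) / u\<^sup>2 - 2 / (u * v) * (u / v * a2) + a2 / v\<^sup>2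
        = q / u\<^sup>2 * (a2 + a1) - a1 / (u * v) - a2 / v\<^sup>2" if "u \<noteq> 0" "v \<noteq> 0" for q u v :: real
      using that by (simp add: field_simps power2_eq_square)
    then show ?thesis using pos(1)[of n] pos(1)[of m] by (metis less_irrefl)
  qed
  \<comment> \<open>With \<open>growth_2_le\<close> the coefficient of a2 + a1 becomes at most
    \<open>1 / (c m)\<^sup>2\<close>, so that a2 cancels; the negative a1 term is dropped.\<close>
  also have "\<dots> \<le> (c n / c m)\<^sup>2 / (c n)\<^sup>2 * (a2 + a1) - 0 - a2 / (c m)\<^sup>2"
    using growth_2_le[OF \<beta> mn] a0 pos[of n] pos[of m]
    by (intro diff_mono mult_right_mono divide_right_mono) (auto simp: c_def g_def)
  also have "\<dots> = a1 / (c m)\<^sup>2"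
    using pos(1)[of n] by (simp add: power_divide add_divide_distrib)
  also have "\<dots> \<le> (\<integral>\<omega>. wt \<beta> x (?T m \<omega>) \<partial>port_space) / (c m)\<^sup>2"
    unfolding a1_def using \<beta>
    by (intro divide_right_mono integral_mono integrable_port) (auto simp: h1_def)
  finally show ?thesis by (simp add: h1_def c_def)
qed

lemma convergent_of_summable_diff:
  fixes u :: "nat \<Rightarrow> real"
  assumes "summable (\<lambda>k. u (Suc k) - u k)"
  shows "convergent u"
proof -
  have "(\<lambda>n. \<Sum>k<n. u (Suc k) - u k) \<longlonglongrightarrow> (\<Sum>k. u (Suc k) - u k)"
    by (rule summable_LIMSEQ[OF assms])
  then have "(\<lambda>n. u n - u 0) \<longlonglongrightarrow> (\<Sum>k. u (Suc k) - u k)"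
    by (simp only: sum_lessThan_telescope)
  from tendsto_add[OF this tendsto_const[of "u 0"]] show ?thesis
    by (auto intro: convergentI)
qed

text \<open>The exponent \<open>p\<close> is chosen so that the second moments of the increments between the times
  \<open>k\<^sup>p\<close> are \<open>O(k\<^sup>-\<^sup>4)\<close>, and stay summable after multiplication by \<open>k\<^sup>2\<close>.\<close>

lemma power_le_norml:
  assumes \<beta>: "0 < \<beta>" and p: "4 * (1 + \<beta>) \<le> real p"
  shows "real k ^ 4 \<le> norml \<beta> (k ^ p)"
proof (cases "k = 0")
  case False
  have "real k ^ 4 = real k powr 4" using False by (simp add: powr_numeral)
  also have "\<dots> \<le> real k powr (real p / (1 + \<beta>))"
    using False \<beta> p by (intro powr_mono) (auto simp: pos_le_divide_eq)
  also have "\<dots> = real (k ^ p) powr (1 / (1 + \<beta>))"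
    using False by (simp add: powr_powr flip: powr_realpow)
  also have "\<dots> \<le> norml \<beta> (k ^ p)"
    using \<beta> by (intro powr_mono2) auto
  finally show ?thesis .
qed simp

text \<open>The squared increments d, weighted with k^2, have summable expectations and hence a
  summable realisation. The inequality 2 |d| \<le> k^-2 + (k d)^2 turns this into absolute
  summability of the increments.\<close>

lemma AE_convergent_subsequence:
  assumes \<beta>: "0 < \<beta>" and x: "\<forall>j\<in>set x. 0 < j" and p: "4 * (1 + \<beta>) \<le> real p"
  shows "AE \<omega> in port_space. (\<exists>m. x \<in> port_aux \<beta> \<omega> m) \<longrightarrow>
    convergent (\<lambda>k. wt \<beta> x (port_aux \<beta> \<omega> (k ^ p)) / growth \<beta> 1 (k ^ p))"
proof -
  let ?T = "\<lambda>n \<omega>. port_aux \<beta> \<omega> n"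
  define M where "M n \<omega> = wt \<beta> x (?T n \<omega>) / growth \<beta> 1 n" for n \<omega>
  define d where "d k \<omega> = M (Suc k ^ p) \<omega> - M (k ^ p) \<omega>" for k \<omega>
  define f where "f k \<omega> = (real k)\<^sup>2 * (of_bool (x \<in> ?T (k ^ p) \<omega>) * (d k \<omega>)\<^sup>2)" for k \<omega>
  have p0: "0 < p" using p \<beta> by (cases p) auto
  obtain K where K: "0 < K" "\<And>n. (\<integral>\<omega>. wt \<beta> x (?T n \<omega>) \<partial>port_space) \<le> K * growth \<beta> 1 n"
    using first_moment_bound[OF \<beta> x] by blast
  obtain B where B: "0 < B" "\<And>n. norml \<beta> n \<le> B * growth \<beta> 1 n"
    using norml_le_growth[OF \<beta>] by blast
  have fi: "integrable port_space (f k)" for k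
    unfolding f_def d_def M_def by (intro integrable_mult_right integrable_port_pair)
  have f0: "0 \<le> f k \<omega>" for k \<omega> by (simp add: f_def)
  have Ef: "(\<integral>\<omega>. f k \<omega> \<partial>port_space) \<le> K * B * inverse (real k ^ 2)" for k
  proof (cases "k = 0")
    case False
    have c: "0 < growth \<beta> 1 (k ^ p)" by (rule growth_pos[OF \<beta>])
    have "(\<integral>\<omega>. f k \<omega> \<partial>port_space) = (real k)\<^sup>2 * (\<integral>\<omega>. of_bool (x \<in> ?T (k ^ p) \<omega>) * (d k \<omega>)\<^sup>2 \<partial>port_space)"
      unfolding f_def by (rule integral_mult_right_zero)
    also have "\<dots> \<le> (real k)\<^sup>2 * ((\<integral>\<omega>. wt \<beta> x (?T (k ^ p) \<omega>) \<partial>port_space) / (growth \<beta> 1 (k ^ p))\<^sup>2)"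
      unfolding d_def M_def
      by (intro mult_left_mono increment_second_moment \<beta> power_mono) auto
    also have "\<dots> \<le> (real k)\<^sup>2 * (K * growth \<beta> 1 (k ^ p) / (growth \<beta> 1 (k ^ p))\<^sup>2)"
      by (intro mult_left_mono divide_right_mono K) auto
    also have "\<dots> = (real k)\<^sup>2 * K * (1 / growth \<beta> 1 (k ^ p))" using c by (simp add: power2_eq_square)
    also have "\<dots> \<le> (real k)\<^sup>2 * K * (B / real k ^ 4)"
    proof (rule mult_left_mono)
      have "real k ^ 4 \<le> B * growth \<beta> 1 (k ^ p)"
        using power_le_norml[OF \<beta> p, of k] B(2)[of "k ^ p"] by (rule order_trans)
      then show "1 / growth \<beta> 1 (k ^ p) \<le> B / real k ^ 4"
        using c False by (simp add: field_simps)
    qed (use K in simp)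
    also have "\<dots> = K * B * inverse (real k ^ 2)"
      using False by (simp add: field_simps eval_nat_numeral)
    finally show ?thesis .
  qed (simp add: f_def)
  have "summable (\<lambda>k. \<integral>\<omega>. f k \<omega> \<partial>port_space)"
  proof (rule summable_comparison_test')
    show "summable (\<lambda>k. K * B * inverse (real k ^ 2))"
      by (intro summable_mult inverse_power_summable) simp
    show "norm (\<integral>\<omega>. f k \<omega> \<partial>port_space) \<le> K * B * inverse (real k ^ 2)" if "0 \<le> k" for k
      using Ef[of k] by (simp add: abs_of_nonneg Bochner_Integration.integral_nonneg f0)
  qed
  from port_prob.AE_summable_of_summable_expectation[OF fi f0 this]
  show ?thesis
  proof eventually_elim
    case (elim \<omega>)
    show ?case
    proof
      assume "\<exists>m. x \<in> ?T m \<omega>"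
      then obtain m where m: "x \<in> ?T m \<omega>" by blast
      have "summable (\<lambda>k. d k \<omega>)"
      \<comment> \<open>From this index on \<open>k ^ p\<close> is at least m, so the indicator in f
        is 1, and k is nonzero, so it can be divided out.\<close>
      proof (rule summable_comparison_test'[where N="Suc m"])
        show "summable (\<lambda>k. inverse (real k ^ 2) + f k \<omega>)"
          by (intro summable_add elim inverse_power_summable) simp
        fix k assume k: "Suc m \<le> k"
        have "k \<le> k ^ p" using k p0 by (simp add: self_le_power)
        then have "x \<in> ?T (k ^ p) \<omega>" using m k port_aux_mono[of m "k ^ p" \<beta> \<omega>] by auto
        then have f: "f k \<omega> = (real k * \<bar>d k \<omega>\<bar>)\<^sup>2" by (simp add: f_def power_mult_distrib)
        have "2 * (inverse (real k) * (real k * \<bar>d k \<omega>\<bar>)) \<le> (inverse (real k))\<^sup>2 + (real k * \<bar>d k \<omega>\<bar>)\<^sup>2"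
          using sum_squares_bound[of "inverse (real k)" "real k * \<bar>d k \<omega>\<bar>"] by (simp add: mult.assoc)
        moreover have "inverse (real k) * (real k * \<bar>d k \<omega>\<bar>) = \<bar>d k \<omega>\<bar>" using k by simp
        ultimately show "norm (d k \<omega>) \<le> inverse (real k ^ 2) + f k \<omega>"
          using f abs_ge_zero[of "d k \<omega>"] unfolding real_norm_def power_inverse by linarith
      qed
      then show "convergent (\<lambda>k. wt \<beta> x (?T (k ^ p) \<omega>) / growth \<beta> 1 (k ^ p))"
        using convergent_of_summable_diff[of "\<lambda>k. M (k ^ p) \<omega>"] by (simp add: d_def M_def)
    qed
  qed
qed

lemma growth_mono: "0 < \<beta> \<Longrightarrow> mono (growth \<beta> r)"
proof (rule incseq_SucI)
  fix n assume "0 < \<beta>"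
  then show "growth \<beta> r n \<le> growth \<beta> r (Suc n)"
    using growth_pos[of \<beta> r n] by (simp add: growth_Suc mult_le_cancel_left1)
qed

text \<open>Growth is comparable to the norming, and ((k + 1)^p + 1) / (k^p + 1) tends to 1. Along
  geometrically growing times the ratio would stay away from 1 and monotone interpolation would
  fail.\<close>

lemma growth_ratio_subsequence:
  assumes \<beta>: "0 < \<beta>" and p: "0 < p"
  shows "(\<lambda>k. growth \<beta> 1 (Suc k ^ p) / growth \<beta> 1 (k ^ p)) \<longlonglongrightarrow> 1"
proof -
  obtain C where C: "0 < C" "(\<lambda>n. growth \<beta> 1 n / norml \<beta> n) \<longlonglongrightarrow> C"
    using growth_over_norml[OF \<beta>] by blast
  have "strict_mono (\<lambda>k. k ^ p :: nat)" using p by (intro strict_monoI power_strict_mono) auto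
  then have top: "filterlim (\<lambda>k. k ^ p :: nat) at_top sequentially" by (rule filterlim_subseq)
  have l1: "(\<lambda>k. growth \<beta> 1 (k ^ p) / norml \<beta> (k ^ p)) \<longlonglongrightarrow> C"
    by (rule filterlim_compose[OF C(2) top])
  have l2: "(\<lambda>k. growth \<beta> 1 (Suc k ^ p) / norml \<beta> (Suc k ^ p)) \<longlonglongrightarrow> C"
    using LIMSEQ_Suc[OF l1] .
  have l3: "(\<lambda>k. norml \<beta> (Suc k ^ p) / norml \<beta> (k ^ p)) \<longlonglongrightarrow> 1"
  proof -
    have a: "(\<lambda>k. (real (Suc k) / real k) ^ p) \<longlonglongrightarrow> 1 ^ p"
      by (intro tendsto_power LIMSEQ_Suc_n_over_n)
    have b: "(\<lambda>k. (1 / real k) ^ p) \<longlonglongrightarrow> 0 ^ p"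
      by (intro tendsto_power lim_1_over_n)
    have "(\<lambda>k. ((real (Suc k) / real k) ^ p + (1 / real k) ^ p) / (1 + (1 / real k) ^ p)) \<longlonglongrightarrow> (1 ^ p + 0 ^ p) / (1 + 0 ^ p)"
      by (rule tendsto_divide[OF tendsto_add[OF a b] tendsto_add[OF tendsto_const b]])
         (simp add: zero_power[OF p])
    moreover have "\<forall>\<^sub>F k in sequentially. ((real (Suc k) / real k) ^ p + (1 / real k) ^ p) / (1 + (1 / real k) ^ p)
        = real (Suc (Suc k ^ p)) / real (Suc (k ^ p))"
      using eventually_gt_at_top[of 0]
    proof eventually_elim
      case (elim k)
      have "0 < real k ^ p" using elim by simp
      then have "((real (Suc k) / real k) ^ p + (1 / real k) ^ p) = (real (Suc k) ^ p + 1) / real k ^ p"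
        "1 + (1 / real k) ^ p = (real k ^ p + 1) / real k ^ p"
        by (simp_all add: power_divide add_divide_distrib del: of_nat_Suc)
      then show ?case using elim by (simp add: add.commute)
    qed
    ultimately have "(\<lambda>k. real (Suc (Suc k ^ p)) / real (Suc (k ^ p))) \<longlonglongrightarrow> 1"
      using Lim_transform_eventually by (fastforce simp: zero_power[OF p] simp del: of_nat_Suc)
    then have "(\<lambda>k. (real (Suc (Suc k ^ p)) / real (Suc (k ^ p))) powr (1 / (1 + \<beta>))) \<longlonglongrightarrow> 1 powr (1 / (1 + \<beta>))"
      by (intro tendsto_powr tendsto_const) auto
    then show ?thesis by (simp add: powr_divide del: of_nat_Suc)
  qed
  have "(\<lambda>k. (growth \<beta> 1 (Suc k ^ p) / norml \<beta> (Suc k ^ p)) / (growth \<beta> 1 (k ^ p) / norml \<beta> (k ^ p))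
      * (norml \<beta> (Suc k ^ p) / norml \<beta> (k ^ p))) \<longlonglongrightarrow> C / C * 1"
    using C(1) by (intro tendsto_mult tendsto_divide l1 l2 l3) auto
  moreover have "(growth \<beta> 1 (Suc k ^ p) / norml \<beta> (Suc k ^ p)) / (growth \<beta> 1 (k ^ p) / norml \<beta> (k ^ p))
      * (norml \<beta> (Suc k ^ p) / norml \<beta> (k ^ p)) = growth \<beta> 1 (Suc k ^ p) / growth \<beta> 1 (k ^ p)" for k
    using norml_pos[of "Suc k ^ p" \<beta>] norml_pos[of "k ^ p" \<beta>] by (simp del: of_nat_Suc power_Suc)
  ultimately show ?thesis using C(1) by simp
qed

lemma AE_convergent_outdeg:
  assumes \<beta>: "0 < \<beta>" and x: "\<forall>j\<in>set x. 0 < j"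
  shows "AE \<omega> in port_space. convergent (\<lambda>n. real (outdeg x (port_aux \<beta> \<omega> n)) / norml \<beta> n)"
proof -
  let ?T = "\<lambda>n \<omega>. port_aux \<beta> \<omega> n"
  define p where "p = nat \<lceil>4 * (1 + \<beta>)\<rceil>"
  have p: "4 * (1 + \<beta>) \<le> real p" unfolding p_def by linarith
  then have p0: "0 < p" using \<beta> by (cases p) auto
  obtain C where C: "0 < C" "(\<lambda>n. growth \<beta> 1 n / norml \<beta> n) \<longlonglongrightarrow> C"
    using growth_over_norml[OF \<beta>] by blast
  show ?thesis
    using AE_convergent_subsequence[OF \<beta> x p]
  proof eventually_elim
    case (elim \<omega>)
    show ?case
    proof (cases "\<exists>m. x \<in> ?T m \<omega>")
      case True
      then obtain L where L: "(\<lambda>k. wt \<beta> x (?T (k ^ p) \<omega>) / growth \<beta> 1 (k ^ p)) \<longlonglongrightarrow> L"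
        using elim by (auto simp: convergent_def)
      have "(\<lambda>n. wt \<beta> x (?T n \<omega>) / growth \<beta> 1 n) \<longlonglongrightarrow> L"
      proof (rule tendsto_of_monotone_subsequence[where f="\<lambda>k. k ^ p"])
        show "strict_mono (\<lambda>k. k ^ p :: nat)" using p0 by (intro strict_monoI power_strict_mono) auto
        show "mono (\<lambda>n. wt \<beta> x (?T n \<omega>))"
          by (rule incseq_SucI) (simp add: outdeg_port_aux_Suc del: port_aux.simps)
        show "mono (growth \<beta> 1)" by (rule growth_mono[OF \<beta>])
        show "(\<lambda>k. growth \<beta> 1 (Suc k ^ p) / growth \<beta> 1 (k ^ p)) \<longlonglongrightarrow> 1"
          by (rule growth_ratio_subsequence[OF \<beta> p0])
      qed (use L p0 \<beta> growth_pos[OF \<beta>] in auto)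
      \<comment> \<open>The factor growth over norming changes the scale, and subtracting
        \<open>\<beta> / norml \<beta> n\<close> passes from the weight to the out-degree.\<close>
      then have "(\<lambda>n. wt \<beta> x (?T n \<omega>) / growth \<beta> 1 n * (growth \<beta> 1 n / norml \<beta> n) - \<beta> / norml \<beta> n) \<longlonglongrightarrow> L * C - 0"
        by (intro tendsto_diff tendsto_mult C real_tendsto_divide_at_top[OF tendsto_const norml_at_top[OF \<beta>]])
      moreover have "wt \<beta> x (?T n \<omega>) / growth \<beta> 1 n * (growth \<beta> 1 n / norml \<beta> n) - \<beta> / norml \<beta> n
          = real (outdeg x (?T n \<omega>)) / norml \<beta> n" for n
      proof -
        have "wt \<beta> x (?T n \<omega>) / growth \<beta> 1 n * (growth \<beta> 1 n / norml \<beta> n) = wt \<beta> x (?T n \<omega>) / norml \<beta> n"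
          using growth_pos[OF \<beta>, of 1 n] by (simp del: of_nat_Suc)
        then show ?thesis by (simp only: add_divide_distrib add_diff_cancel_right')
      qed
      ultimately show ?thesis by (auto intro: convergentI)
    next
      case False
      then have "outdeg x (?T n \<omega>) = 0" for n
        using outdeg_notin[OF plane_tree_port_aux] by blast
      then show ?thesis by (simp add: convergent_const)
    qed
  qed
qed

section \<open>The limit variable and its moments\<close>

definition zeta :: "real \<Rightarrow> nat list \<Rightarrow> (nat \<Rightarrow> real) \<Rightarrow> real" where
  "zeta \<beta> x \<omega> = lim (\<lambda>n. real (outdeg x (port_aux \<beta> \<omega> n)) / norml \<beta> n)"

lemma measurable_zeta [measurable]: "zeta \<beta> x \<in> borel_measurable port_space"
  unfolding zeta_def
  by (rule borel_measurable_lim_metric)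
     (rule measurable_port_pair[of "\<lambda>_ T. real (outdeg x T) / norml \<beta> n" for n])

lemma AE_tendsto_zeta:
  assumes "0 < \<beta>" and "\<forall>j\<in>set x. 0 < j"
  shows "AE \<omega> in port_space. (\<lambda>n. real (outdeg x (port_aux \<beta> \<omega> n)) / norml \<beta> n) \<longlonglongrightarrow> zeta \<beta> x \<omega>"
  using AE_convergent_outdeg[OF assms] by eventually_elim (simp only: zeta_def convergent_LIMSEQ_iff)

lemma AE_zeta_nonneg:
  assumes "0 < \<beta>" and "\<forall>j\<in>set x. 0 < j"
  shows "AE \<omega> in port_space. 0 \<le> zeta \<beta> x \<omega>"
  using AE_tendsto_zeta[OF assms] by eventually_elim (rule LIMSEQ_le_const, auto)

text \<open>The rising factorial of length 2 r splits into two of length r, the second starting at w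
  + r. The 2r-th moments therefore bound the second moments of the r-th rising factorials.\<close>

lemma pochhammer_square_le:
  fixes w :: real assumes "0 \<le> w"
  shows "(pochhammer w r)\<^sup>2 \<le> pochhammer w (2 * r)"
proof -
  have "pochhammer w r \<le> pochhammer (w + real r) r"
    unfolding pochhammer_prod using assms by (intro prod_mono) auto
  moreover have "0 \<le> pochhammer w r"
    unfolding pochhammer_prod using assms by (intro prod_nonneg) auto
  ultimately have "pochhammer w r * pochhammer w r \<le> pochhammer w r * pochhammer (w + real r) r"
    by (rule mult_left_mono)
  then show ?thesis by (simp add: pochhammer_product' mult_2 power2_eq_square)
qed

text \<open>The normalised rising factorials Y converge almost surely to the r-th power of the
  limit. Their second moments are bounded through the convergent moments of order 2 r, so the
  expectations converge as well.\<close>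

lemma zeta_moments:
  assumes \<beta>: "0 < \<beta>" and x: "\<forall>j\<in>set x. 0 < j"
  shows "integrable port_space (\<lambda>\<omega>. zeta \<beta> x \<omega> ^ r)"
    and "(\<integral>\<omega>. zeta \<beta> x \<omega> ^ r \<partial>port_space) = moment \<beta> x r"
proof -
  let ?T = "\<lambda>n \<omega>. port_aux \<beta> \<omega> n"
  define Y where "Y n \<omega> = pochhammer (wt \<beta> x (?T n \<omega>)) r / norml \<beta> n ^ r" for n \<omega>
  have Yint: "integrable port_space (\<lambda>\<omega>. \<phi> (Y n \<omega>))" for \<phi> :: "real \<Rightarrow> real" and n
    unfolding Y_def by (rule integrable_port)
  have "(\<lambda>n. (\<integral>\<omega>. pochhammer (wt \<beta> x (?T n \<omega>)) (2 * r) \<partial>port_space) / norml \<beta> n ^ (2 * r)) \<longlonglongrightarrow> moment \<beta> x (2 * r)"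
    by (rule moment_limit[OF \<beta> x])
  then have "Bseq (\<lambda>n. (\<integral>\<omega>. pochhammer (wt \<beta> x (?T n \<omega>)) (2 * r) \<partial>port_space) / norml \<beta> n ^ (2 * r))"
    by (intro convergent_imp_Bseq convergentI)
  then obtain C where "0 < C" and C: "\<And>n. norm ((\<integral>\<omega>. pochhammer (wt \<beta> x (?T n \<omega>)) (2 * r) \<partial>port_space) / norml \<beta> n ^ (2 * r)) \<le> C"
    by (auto elim: BseqE)
  have bd: "(\<integral>\<omega>. (Y n \<omega>)\<^sup>2 \<partial>port_space) \<le> C" for n
  proof -
    have "(\<integral>\<omega>. (Y n \<omega>)\<^sup>2 \<partial>port_space) \<le> (\<integral>\<omega>. pochhammer (wt \<beta> x (?T n \<omega>)) (2 * r) / norml \<beta> n ^ (2 * r) \<partial>port_space)"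
    proof (rule integral_mono[OF Yint integrable_port])
      fix \<omega>
      show "(Y n \<omega>)\<^sup>2 \<le> pochhammer (wt \<beta> x (?T n \<omega>)) (2 * r) / norml \<beta> n ^ (2 * r)"
        using pochhammer_square_le[of "wt \<beta> x (?T n \<omega>)" r] wt_pos[OF \<beta>, of x "?T n \<omega>"]
        unfolding Y_def power_divide power_even_eq[of "norml \<beta> n"] by (intro divide_right_mono) auto
    qed
    also have "\<dots> \<le> C" unfolding integral_divide_zero using C[of n] by (simp only: real_norm_def abs_le_iff)
    finally show ?thesis .
  qed
  have lim: "AE \<omega> in port_space. (\<lambda>n. Y n \<omega>) \<longlonglongrightarrow> zeta \<beta> x \<omega> ^ r"
    using AE_tendsto_zeta[OF \<beta> x]
  proof eventually_elim
    case (elim \<omega>)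
    \<comment> \<open>Each of the r factors carries a fixed shift \<beta> + i, which the norming
      sends to 0.\<close>
    have "(\<lambda>n. \<Prod>i=0..<r. real (outdeg x (?T n \<omega>)) / norml \<beta> n + (\<beta> + real i) / norml \<beta> n) \<longlonglongrightarrow> (\<Prod>i=0..<r. zeta \<beta> x \<omega> + 0)"
      by (intro tendsto_prod tendsto_add elim real_tendsto_divide_at_top[OF tendsto_const norml_at_top[OF \<beta>]])
    moreover have "(\<Prod>i=0..<r. real (outdeg x (?T n \<omega>)) / norml \<beta> n + (\<beta> + real i) / norml \<beta> n) = Y n \<omega>" for n
      by (simp add: Y_def pochhammer_prod prod_dividef add.assoc flip: add_divide_distrib del: of_nat_Suc)
    ultimately show ?case by simp
  qed
  have [measurable]: "Y n \<in> borel_measurable port_space" for n using Yint[of "\<lambda>y. y"] by auto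
  have Y0: "0 \<le> Y n \<omega>" for n \<omega>
    unfolding Y_def using wt_pos[OF \<beta>, of x "?T n \<omega>"]
    by (intro divide_nonneg_nonneg less_imp_le[OF pochhammer_pos] zero_le_power) auto
  note * = port_prob.tendsto_expectation_of_bounded_second_moment[OF _ _ lim Y0 Yint bd]
  show "integrable port_space (\<lambda>\<omega>. zeta \<beta> x \<omega> ^ r)" by (rule *(1)) measurable
  have "(\<lambda>n. \<integral>\<omega>. Y n \<omega> \<partial>port_space) \<longlonglongrightarrow> (\<integral>\<omega>. zeta \<beta> x \<omega> ^ r \<partial>port_space)"
    by (rule *(2)) measurable
  moreover have "(\<lambda>n. \<integral>\<omega>. Y n \<omega> \<partial>port_space) \<longlonglongrightarrow> moment \<beta> x r"
    unfolding Y_def using moment_limit[OF \<beta> x, of r] by simp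
  ultimately show "(\<integral>\<omega>. zeta \<beta> x \<omega> ^ r \<partial>port_space) = moment \<beta> x r"
    by (rule LIMSEQ_unique)
qed

section \<open>The distribution of the limit\<close>

lemma sets_beta_measure [simp, measurable_cong]: "sets (beta_measure a b) = sets borel"
  by (simp add: beta_measure_def)

text \<open>Multiplying the density by t^r shifts its first parameter to a + r. The moment is thus a
  quotient of two Beta values, and the Gamma factors leave the rising factorials.\<close>

lemma nn_integral_beta_measure:
  assumes a: "0 < a" and b: "0 < b"
  shows "(\<integral>\<^sup>+t. ennreal (\<bar>t\<bar> ^ r) \<partial>beta_measure a b) = ennreal (pochhammer a r / pochhammer (a + b) r)"
proof -
  let ?f = "\<lambda>t. t powr (a + real r - 1) * (1 - t) powr (b - 1)"
  have Bpos: "0 < Beta a b" using a b unfolding Beta_def by (intro divide_pos_pos mult_pos_pos Gamma_real_pos) auto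
  have "(?f has_integral Beta (a + real r) b) {0<..<1}"
    using has_integral_Beta_real[of "a + real r" b] a b by (simp add: has_integral_Icc_iff_Ioo)
  then have I: "(\<integral>\<^sup>+t. ennreal (indicator {0<..<1} t * ?f t) \<partial>lborel) = ennreal (Beta (a + real r) b)"
    by (intro nn_integral_has_integral_lebesgue) auto
  have "(\<integral>\<^sup>+t. ennreal (\<bar>t\<bar> ^ r) \<partial>beta_measure a b) =
      (\<integral>\<^sup>+t. ennreal (indicator {0<..<1} t * t powr (a - 1) * (1 - t) powr (b - 1) / Beta a b) * ennreal (\<bar>t\<bar> ^ r) \<partial>lborel)"
    unfolding beta_measure_def by (subst nn_integral_density) auto
  also have "\<dots> = (\<integral>\<^sup>+t. ennreal (1 / Beta a b) * ennreal (indicator {0<..<1} t * ?f t) \<partial>lborel)"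
  proof (rule nn_integral_cong)
    fix t :: real
    show "ennreal (indicator {0<..<1} t * t powr (a - 1) * (1 - t) powr (b - 1) / Beta a b) * ennreal (\<bar>t\<bar> ^ r)
      = ennreal (1 / Beta a b) * ennreal (indicator {0<..<1} t * ?f t)"
    proof (cases "t \<in> {0<..<1}")
      case True
      have "t powr (a + real r - 1) = t powr (a - 1) * t ^ r"
        using True by (simp add: powr_realpow[symmetric] powr_add[symmetric] algebra_simps)
      then show ?thesis
        using True Bpos by (simp add: ennreal_mult'[symmetric] mult_ac)
    qed simp
  qed
  also have "\<dots> = ennreal (1 / Beta a b) * ennreal (Beta (a + real r) b)"
    by (subst nn_integral_cmult) (auto simp: I)
  also have "\<dots> = ennreal (Beta (a + real r) b / Beta a b)"
    using Bpos by (simp add: ennreal_mult'[symmetric])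
  also have "Beta (a + real r) b / Beta a b = pochhammer a r / pochhammer (a + b) r"
  proof -
    have ne: "a \<notin> \<int>\<^sub>\<le>\<^sub>0" "a + b \<notin> \<int>\<^sub>\<le>\<^sub>0" using a b by (auto intro!: pos_notin_nonpos_Ints)
    have "Gamma a > 0" "Gamma b > 0" "Gamma (a + b) > 0" "Gamma (a + real r) > 0" "Gamma (a + b + real r) > 0"
      using a b by (auto intro!: Gamma_real_pos)
    then show ?thesis
      by (simp add: Beta_def pochhammer_Gamma[OF ne(1)] pochhammer_Gamma[OF ne(2)] add_ac)
  qed
  finally show ?thesis .
qed

lemma prob_space_beta_measure:
  assumes "0 < a" "0 < b"
  shows "prob_space (beta_measure a b)"
proof
  have "emeasure (beta_measure a b) (space (beta_measure a b)) = (\<integral>\<^sup>+t. ennreal (\<bar>t\<bar> ^ 0) \<partial>beta_measure a b)"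
    by simp
  also have "\<dots> = 1" by (subst nn_integral_beta_measure[OF assms]) simp
  finally show "emeasure (beta_measure a b) (space (beta_measure a b)) = 1" .
qed

lemma AE_beta_measure_pos: "AE t in beta_measure a b. 0 < t"
  unfolding beta_measure_def by (subst AE_density) (auto simp: indicator_def)

lemma beta_measure_moments:
  assumes a: "0 < a" and b: "0 < b"
  shows "has_bochner_integral (beta_measure a b) (\<lambda>t. \<bar>t\<bar> ^ r) (pochhammer a r / pochhammer (a + b) r)"
    and "has_bochner_integral (beta_measure a b) (\<lambda>t. t ^ r) (pochhammer a r / pochhammer (a + b) r)"
proof -
  have "(\<lambda>t::real. \<bar>t\<bar> ^ r) \<in> borel_measurable (beta_measure a b)"
    unfolding measurable_cong_sets[OF sets_beta_measure refl] by measurable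
  moreover have "0 \<le> pochhammer a r / pochhammer (a + b) r"
    using a b by (intro divide_nonneg_nonneg less_imp_le[OF pochhammer_pos]) auto
  ultimately show *: "has_bochner_integral (beta_measure a b) (\<lambda>t. \<bar>t\<bar> ^ r) (pochhammer a r / pochhammer (a + b) r)"
    by (intro has_bochner_integral_nn_integral nn_integral_beta_measure a b) auto
  have "AE t in beta_measure a b. \<bar>t\<bar> ^ r = t ^ r"
    using AE_beta_measure_pos by eventually_elim simp
  then show "has_bochner_integral (beta_measure a b) (\<lambda>t. t ^ r) (pochhammer a r / pochhammer (a + b) r)"
    using * by (subst (asm) has_bochner_integral_cong_AE) auto
qed

text \<open>A multiplicative \<phi> covers plain and absolute powers at once; independence then
  factorises the integral by Fubini.\<close>

lemma integral_multiplicative_product: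
  fixes \<phi> :: "real \<Rightarrow> real" and D :: "real measure" and B :: "'i \<Rightarrow> real measure" and I :: "'i set"
  defines "N \<equiv> distr (D \<Otimes>\<^sub>M PiM I B) borel (\<lambda>(z, \<xi>). z * (\<Prod>s\<in>I. \<xi> s))"
  assumes I: "finite I" and D: "prob_space D" and sets_D: "sets D = sets borel"
    and B: "\<And>s. s \<in> I \<Longrightarrow> prob_space (B s)" and sets_B: "\<And>s. s \<in> I \<Longrightarrow> sets (B s) = sets borel"
    and \<phi>: "\<phi> \<in> borel_measurable borel" "\<And>x y. \<phi> (x * y) = \<phi> x * \<phi> y" "\<phi> 1 = 1"
    and int_D: "integrable D \<phi>" and int_B: "\<And>s. s \<in> I \<Longrightarrow> integrable (B s) \<phi>"
  shows "real_distribution N" and "integrable N \<phi>"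
    and "(\<integral>x. \<phi> x \<partial>N) = (\<integral>x. \<phi> x \<partial>D) * (\<Prod>s\<in>I. \<integral>x. \<phi> x \<partial>B s)"
proof -
  \<comment> \<open>The family is completed outside I by the probability measure D, since the locale
    for product measures asks for a condition at every index.\<close>
  define B' where "B' s = (if s \<in> I then B s else D)" for s
  define P where "P = PiM I B'"
  have P: "PiM I B = P" unfolding P_def by (rule PiM_cong) (auto simp: B'_def)
  interpret D: prob_space D by fact
  interpret B': prob_space "B' s" for s using B D by (auto simp: B'_def)
  interpret PB: product_sigma_finite B' by unfold_locales
  interpret P: prob_space P unfolding P_def by (intro prob_space_PiM B'.prob_space_axioms)
  interpret DP: pair_prob_space D P ..
  have sets_B': "sets (B' s) = sets borel" for s using sets_B sets_D by (auto simp: B'_def)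
  note [measurable_cong] = sets_D sets_B'
  have [measurable]: "(\<lambda>\<xi>. \<xi> s) \<in> borel_measurable P" if "s \<in> I" for s
    using measurable_component_singleton[OF that, of B'] sets_B'[of s]
    unfolding P_def by (simp cong: measurable_cong_sets)
  have [measurable]: "(\<lambda>\<xi>. \<Prod>s\<in>I. \<xi> s) \<in> borel_measurable P"
    by (rule borel_measurable_prod) simp
  have m: "(\<lambda>(z, \<xi>). z * (\<Prod>s\<in>I. \<xi> s)) \<in> borel_measurable (D \<Otimes>\<^sub>M P)"
    by measurable
  have DPp: "prob_space (D \<Otimes>\<^sub>M P)" by (rule DP.prob_space_axioms)
  show "real_distribution N"
    unfolding N_def P by (rule prob_space.real_distribution_distr[OF DPp m])
  have \<phi>_prod: "\<phi> (\<Prod>s\<in>J. u s) = (\<Prod>s\<in>J. \<phi> (u s))" if "finite J" for J and u :: "'i \<Rightarrow> real"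
    using that by (induction J) (auto simp: \<phi>)
  have i': "integrable (B' s) \<phi>" if "s \<in> I" for s using int_B that by (simp add: B'_def)
  have gi: "integrable P (\<lambda>\<xi>. \<phi> (\<Prod>s\<in>I. \<xi> s))"
    unfolding \<phi>_prod[OF I] P_def using I i' by (rule PB.product_integrable_prod)
  have gI: "(\<integral>\<xi>. \<phi> (\<Prod>s\<in>I. \<xi> s) \<partial>P) = (\<Prod>s\<in>I. \<integral>x. \<phi> x \<partial>B s)"
    unfolding \<phi>_prod[OF I] P_def
    by (subst PB.product_integral_prod[OF I i']) (auto simp: B'_def intro!: prod.cong)
  note [measurable] = \<phi>(1)
  have pi: "integrable (D \<Otimes>\<^sub>M P) (\<lambda>(z, \<xi>). \<phi> z * \<phi> (\<Prod>s\<in>I. \<xi> s))"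
  proof (rule DP.Fubini_integrable)
    show "integrable D (\<lambda>z. \<integral>\<xi>. norm (case (z, \<xi>) of (z, \<xi>) \<Rightarrow> \<phi> z * \<phi> (\<Prod>s\<in>I. \<xi> s)) \<partial>P)"
      using int_D by (simp add: abs_mult)
    show "AE z in D. integrable P (\<lambda>\<xi>. case (z, \<xi>) of (z, \<xi>) \<Rightarrow> \<phi> z * \<phi> (\<Prod>s\<in>I. \<xi> s))"
      using gi by simp
  qed measurable
  have pe: "\<phi> (case p of (z, \<xi>) \<Rightarrow> z * (\<Prod>s\<in>I. \<xi> s)) = (case p of (z, \<xi>) \<Rightarrow> \<phi> z * \<phi> (\<Prod>s\<in>I. \<xi> s))" for p
    by (simp add: \<phi> split: prod.split)
  show "integrable N \<phi>"
    unfolding N_def P by (subst integrable_distr_eq[OF m]) (simp_all only: pe pi \<phi>(1))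
  have "(\<integral>x. \<phi> x \<partial>N) = (\<integral>p. (case p of (z, \<xi>) \<Rightarrow> \<phi> z * \<phi> (\<Prod>s\<in>I. \<xi> s)) \<partial>(D \<Otimes>\<^sub>M P))"
    unfolding N_def P by (subst integral_distr[OF m]) (simp_all only: pe \<phi>(1))
  also have "\<dots> = (\<integral>z. \<phi> z * (\<integral>\<xi>. \<phi> (\<Prod>s\<in>I. \<xi> s) \<partial>P) \<partial>D)"
    using DP.integral_fst'[OF pi] by simp
  also have "\<dots> = (\<integral>x. \<phi> x \<partial>D) * (\<Prod>s\<in>I. \<integral>x. \<phi> x \<partial>B s)"
    by (simp add: gI)
  finally show "(\<integral>x. \<phi> x \<partial>N) = (\<integral>x. \<phi> x \<partial>D) * (\<Prod>s\<in>I. \<integral>x. \<phi> x \<partial>B s)" .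
qed

section \<open>Nondegeneracy and identification of the law\<close>

lemma moment0_pos: "0 < \<beta> \<Longrightarrow> 0 < moment0 \<beta> r"
  by (auto simp: moment0_def intro!: mult_pos_pos divide_pos_pos pochhammer_pos Gamma_real_pos add_pos_nonneg)

lemma moment_eq_prod:
  "moment \<beta> x r = moment0 \<beta> r * (\<Prod>s\<in>{1..length x}. pochhammer \<beta> r / pochhammer (\<beta> + real (x ! (s - 1))) r)"
proof -
  have "(\<Prod>j\<leftarrow>x. pochhammer \<beta> r / pochhammer (\<beta> + real j) r)
      = (\<Prod>i=0..<length x. pochhammer \<beta> r / pochhammer (\<beta> + real (x ! i)) r)"
    by (simp add: prod.list_conv_set_nth)
  also have "\<dots> = (\<Prod>s\<in>{1..length x}. pochhammer \<beta> r / pochhammer (\<beta> + real (x ! (s - 1))) r)"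
    by (rule prod.reindex_bij_witness[of _ "\<lambda>s. s - 1" Suc]) auto
  finally show ?thesis by (simp add: moment_def)
qed

text \<open>Rising factorials increase with their base, so every factor lies between 0 and 1.
  Summability of the moment series is thereby inherited from the root.\<close>

lemma moment_bounds:
  assumes \<beta>: "0 < \<beta>"
  shows "0 \<le> moment \<beta> x r" "moment \<beta> x r \<le> moment0 \<beta> r"
proof -
  have pos: "0 < pochhammer \<beta> r" using \<beta> by (rule pochhammer_pos)
  have le: "pochhammer \<beta> r \<le> pochhammer (\<beta> + real j) r" for j
    unfolding pochhammer_prod using \<beta> by (intro prod_mono) auto
  have "0 \<le> (\<Prod>s\<in>A. pochhammer \<beta> r / pochhammer (\<beta> + real (f s)) r)"
    "(\<Prod>s\<in>A. pochhammer \<beta> r / pochhammer (\<beta> + real (f s)) r) \<le> 1" for A and f :: "nat \<Rightarrow> nat"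
    using pos le less_le_trans[OF pos le]
    by (auto intro!: prod_nonneg prod_le_1 simp: less_imp_le)
  then show "0 \<le> moment \<beta> x r" "moment \<beta> x r \<le> moment0 \<beta> r"
    using moment0_pos[OF \<beta>, of r] unfolding moment_eq_prod
    by (auto intro!: mult_nonneg_nonneg mult_left_le simp: less_imp_le)
qed

lemma summable_moment:
  assumes \<beta>: "0 < \<beta>"
  shows "summable (\<lambda>r. moment \<beta> x r * \<bar>t\<bar> ^ r / fact r)"
proof (rule summable_comparison_test'[OF summable_moment0[OF \<beta>, of t]])
  fix r :: nat
  show "norm (moment \<beta> x r * \<bar>t\<bar> ^ r / fact r) \<le> moment0 \<beta> r * \<bar>t\<bar> ^ r / fact r"
    using moment_bounds[OF \<beta>, of x r] by (simp add: abs_mult divide_right_mono mult_right_mono)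
qed

text \<open>Each Beta factor satisfies the weak inequality, because \<beta> / (\<beta> + j) \<le>
  (\<beta> + 1) / (\<beta> + j + 1). Strictness comes from the root factor.\<close>

lemma moment_log_convex:
  assumes \<beta>: "0 < \<beta>"
  shows "(moment \<beta> x 1)\<^sup>2 < moment \<beta> x 2"
proof -
  define P where "P r = (\<Prod>j\<leftarrow>x. pochhammer \<beta> r / pochhammer (\<beta> + real j) r)" for r
  have "0 < P 1 \<and> (P 1)\<^sup>2 \<le> P 2"
    unfolding P_def
  proof (induction x)
    case (Cons j x)
    have "0 \<le> real j" by simp
    then have "\<beta> / (\<beta> + real j) \<le> (\<beta> + 1) / (\<beta> + real j + 1)"
      using \<beta> by (simp add: field_simps)
    then have "\<beta> / (\<beta> + real j) * (\<beta> / (\<beta> + real j)) \<le> \<beta> / (\<beta> + real j) * ((\<beta> + 1) / (\<beta> + real j + 1))"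
      using \<beta> by (intro mult_left_mono) auto
    then have "(pochhammer \<beta> 1 / pochhammer (\<beta> + real j) 1)\<^sup>2 \<le> pochhammer \<beta> 2 / pochhammer (\<beta> + real j) 2"
      by (simp add: eval_nat_numeral pochhammer_Suc)
    moreover have "0 < pochhammer \<beta> 1 / pochhammer (\<beta> + real j) 1"
      using \<beta> by (simp add: add_pos_nonneg)
    ultimately show ?case
      using Cons order_trans[OF zero_le_power2] unfolding list.map prod_list.Cons power_mult_distrib
      by (intro conjI mult_pos_pos mult_mono) auto
  qed simp
  then have P: "0 < P 1" "(P 1)\<^sup>2 \<le> P 2" by auto
  have "(moment \<beta> x 1)\<^sup>2 = (moment0 \<beta> 1)\<^sup>2 * (P 1)\<^sup>2" by (simp add: moment_def P_def power_mult_distrib)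
  also have "\<dots> < moment0 \<beta> 2 * (P 1)\<^sup>2"
    using moment0_log_convex[OF \<beta>] P(1) by (intro mult_strict_right_mono) auto
  also have "\<dots> \<le> moment0 \<beta> 2 * P 2"
    using P(2) moment0_pos[OF \<beta>, of 2] by (intro mult_left_mono) auto
  also have "\<dots> = moment \<beta> x 2" by (simp add: moment_def P_def)
  finally show ?thesis .
qed

text \<open>A limit almost surely equal to c would have the moments c^r, for which
  \<open>moment_log_convex\<close> is an equality.\<close>

lemma nondegenerate_zeta:
  assumes \<beta>: "0 < \<beta>" and x: "\<forall>j\<in>set x. 0 < j"
  shows "nondegenerate port_space (zeta \<beta> x)"
  unfolding nondegenerate_def
proof
  assume "\<exists>c. AE \<omega> in port_space. zeta \<beta> x \<omega> = c"
  then obtain c where c: "AE \<omega> in port_space. zeta \<beta> x \<omega> = c" by blast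
  have "moment \<beta> x r = c ^ r" for r
  proof -
    have "(\<integral>\<omega>. zeta \<beta> x \<omega> ^ r \<partial>port_space) = (\<integral>\<omega>. c ^ r \<partial>port_space)"
    proof (rule integral_cong_AE)
      show "AE \<omega> in port_space. zeta \<beta> x \<omega> ^ r = c ^ r" using c by eventually_elim simp
    qed measurable
    then show ?thesis using zeta_moments(2)[OF \<beta> x, of r] by (simp add: port_prob.prob_space)
  qed
  then show False using moment_log_convex[OF \<beta>, of x] by simp
qed

text \<open>The degree exceeds the out-degree by at most the edge to the parent, which the norming
  removes; the index moves by one because \<open>PORT\<close> counts vertices.\<close>

lemma AE_tendsto_deg:
  assumes \<beta>: "0 < \<beta>" and x: "\<forall>j\<in>set x. 0 < j"
  shows "AE \<omega> in port_space. (\<lambda>n. real (deg x (PORT \<beta> \<omega> n)) / real n powr (1 / (1 + \<beta>))) \<longlonglongrightarrow> zeta \<beta> x \<omega>"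
  using AE_tendsto_zeta[OF \<beta> x]
proof eventually_elim
  case (elim \<omega>)
  let ?b = "\<lambda>n. if x \<noteq> [] \<and> x \<in> port_aux \<beta> \<omega> n then 1 else 0 :: real"
  have "(\<lambda>n. ?b n / norml \<beta> n) \<longlonglongrightarrow> 0"
  proof (rule Lim_null_comparison)
    show "(\<lambda>n. 1 / norml \<beta> n) \<longlonglongrightarrow> 0"
      by (intro real_tendsto_divide_at_top[OF tendsto_const norml_at_top[OF \<beta>]])
    show "\<forall>\<^sub>F n in sequentially. norm (?b n / norml \<beta> n) \<le> 1 / norml \<beta> n"
      by (intro always_eventually allI) auto
  qed
  moreover have "real (deg x (PORT \<beta> \<omega> (Suc n))) / real (Suc n) powr (1 / (1 + \<beta>))
      = real (outdeg x (port_aux \<beta> \<omega> n)) / norml \<beta> n + ?b n / norml \<beta> n" for n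
    by (auto simp: deg_def PORT_def add_divide_distrib)
  ultimately have "(\<lambda>n. real (deg x (PORT \<beta> \<omega> (Suc n))) / real (Suc n) powr (1 / (1 + \<beta>))) \<longlonglongrightarrow> zeta \<beta> x \<omega>"
    using tendsto_add[OF elim] by fastforce
  then show ?case by (rule LIMSEQ_imp_Suc)
qed

lemma zeta_abs_moments:
  assumes \<beta>: "0 < \<beta>" and x: "\<forall>j\<in>set x. 0 < j"
  shows "integrable port_space (\<lambda>\<omega>. \<bar>zeta \<beta> x \<omega>\<bar> ^ r)"
    and "(\<integral>\<omega>. \<bar>zeta \<beta> x \<omega>\<bar> ^ r \<partial>port_space) = moment \<beta> x r"
proof -
  have e: "AE \<omega> in port_space. zeta \<beta> x \<omega> ^ r = \<bar>zeta \<beta> x \<omega>\<bar> ^ r"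
    using AE_zeta_nonneg[OF \<beta> x] by eventually_elim simp
  show "integrable port_space (\<lambda>\<omega>. \<bar>zeta \<beta> x \<omega>\<bar> ^ r)"
    by (rule integrable_cong_AE_imp[OF zeta_moments(1)[OF \<beta> x, of r] _ e]) measurable
  show "(\<integral>\<omega>. \<bar>zeta \<beta> x \<omega>\<bar> ^ r \<partial>port_space) = moment \<beta> x r"
    unfolding zeta_moments(2)[OF \<beta> x, symmetric]
    by (rule integral_cong_AE[symmetric, OF _ _ e]) measurable
qed

text \<open>Both laws have the moments \<open>moment \<beta> x r\<close>. Absolute and plain moments
  agree on each side because the limits and the Beta variables are almost surely nonnegative, so the
  moment problem applies.\<close>

lemma distr_zeta:
  assumes \<beta>: "0 < \<beta>" and x: "\<forall>j\<in>set x. 0 < j"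
  shows "distr port_space borel (zeta \<beta> x) =
      distr (distr port_space borel (zeta \<beta> []) \<Otimes>\<^sub>M
             PiM {1..length x} (\<lambda>s. beta_measure \<beta> (real (x ! (s - 1)))))
        borel (\<lambda>(z, \<xi>). z * (\<Prod>s\<in>{1..length x}. \<xi> s))" (is "?M = ?N")
proof (rule moment_determinacy[where \<mu>="moment \<beta> x"])
  let ?D = "distr port_space borel (zeta \<beta> [])"
  let ?B = "\<lambda>s. beta_measure \<beta> (real (x ! (s - 1)))"
  have xs: "0 < real (x ! (s - 1))" if "s \<in> {1..length x}" for s using x that by (auto simp: all_set_conv_all_nth)
  have nil: "\<forall>j\<in>set ([] :: nat list). 0 < j" by simp
  have m0: "moment \<beta> [] r = moment0 \<beta> r" for r by (simp add: moment_def)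
  have D: "prob_space ?D" by (rule port_prob.prob_space_distr) measurable
  note N = integral_multiplicative_product[where I="{1..length x}" and D="?D" and B="?B",
      OF _ D _ prob_space_beta_measure[OF \<beta> xs] sets_beta_measure]
  have D_int: "integrable ?D (\<lambda>x. x ^ r)" "(\<integral>x. x ^ r \<partial>?D) = moment0 \<beta> r"
    "integrable ?D (\<lambda>x. \<bar>x\<bar> ^ r)" "(\<integral>x. \<bar>x\<bar> ^ r \<partial>?D) = moment0 \<beta> r" for r
    using zeta_moments[OF \<beta> nil, of r] zeta_abs_moments[OF \<beta> nil, of r]
    by (simp_all add: integrable_distr_eq integral_distr m0)
  note Bm = beta_measure_moments[OF \<beta> xs]
  have N_pow: "real_distribution ?N" "integrable ?N (\<lambda>x. x ^ r)" "(\<integral>x. x ^ r \<partial>?N) = moment \<beta> x r" for r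
    using N[of "\<lambda>x. x ^ r"] D_int(1,2)[of r] has_bochner_integral_integrable
      Bm(2)[THEN has_bochner_integral_integral_eq] Bm(2)[unfolded has_bochner_integral_iff]
    by (auto simp: power_mult_distrib moment_eq_prod)
  have N_abs: "integrable ?N (\<lambda>x. \<bar>x\<bar> ^ r)" "(\<integral>x. \<bar>x\<bar> ^ r \<partial>?N) = moment \<beta> x r" for r
    using N[of "\<lambda>x. \<bar>x\<bar> ^ r"] D_int(3,4)[of r] Bm(1)[unfolded has_bochner_integral_iff]
    by (auto simp: power_mult_distrib abs_mult moment_eq_prod)
  have M_int: "(\<integral>x. x ^ r \<partial>?M) = moment \<beta> x r"
    "integrable ?M (\<lambda>x. \<bar>x\<bar> ^ r)" "(\<integral>x. \<bar>x\<bar> ^ r \<partial>?M) = moment \<beta> x r" for r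
    using zeta_moments[OF \<beta> x, of r] zeta_abs_moments[OF \<beta> x, of r]
    by (simp_all add: integrable_distr_eq integral_distr)
  show "real_distribution ?M" by (rule port_prob.real_distribution_distr) measurable
  show "real_distribution ?N" by (rule N_pow(1))
  show "integrable ?M (\<lambda>x. \<bar>x\<bar> ^ r)" "integrable ?N (\<lambda>x. \<bar>x\<bar> ^ r)"
    "(\<integral>x. \<bar>x\<bar> ^ r \<partial>?M) = moment \<beta> x r" "(\<integral>x. \<bar>x\<bar> ^ r \<partial>?N) = moment \<beta> x r"
    "(\<integral>x. x ^ r \<partial>?M) = (\<integral>x. x ^ r \<partial>?N)" for r
    using M_int[of r] N_pow(3)[of r] N_abs[of r] by simp_all
  show "summable (\<lambda>r. moment \<beta> x r * \<bar>t\<bar> ^ r / fact r)" for t by (rule summable_moment[OF \<beta>])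
qed

theorem theorem2:
  fixes \<beta> :: real and x :: "nat list"
  assumes "\<beta> > 0" and "x \<noteq> []" and "\<forall>i\<in>set x. i > 0"
  shows "\<exists>\<zeta> \<zeta>0.
    \<zeta> \<in> borel_measurable port_space \<and>
    (AE \<omega> in port_space.
       (\<lambda>n. real (deg x (PORT \<beta> \<omega> n)) / real n powr (1 / (1 + \<beta>))) \<longlonglongrightarrow> \<zeta> \<omega>) \<and>
    nondegenerate port_space \<zeta> \<and>
    \<zeta>0 \<in> borel_measurable port_space \<and>
    (AE \<omega> in port_space.
       (\<lambda>n. real (deg [] (PORT \<beta> \<omega> n)) / real n powr (1 / (1 + \<beta>))) \<longlonglongrightarrow> \<zeta>0 \<omega>) \<and>
    nondegenerate port_space \<zeta>0 \<and>
    distr port_space borel \<zeta> =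
      distr (distr port_space borel \<zeta>0 \<Otimes>\<^sub>M
             PiM {1..length x} (\<lambda>s. beta_measure \<beta> (real (x ! (s - 1)))))
        borel (\<lambda>(z, \<xi>). z * (\<Prod>s\<in>{1..length x}. \<xi> s))"
proof (intro exI conjI)
  have x: "\<forall>j\<in>set x. 0 < j" and nil: "\<forall>j\<in>set ([] :: nat list). 0 < j" using assms(3) by auto
  show "zeta \<beta> x \<in> borel_measurable port_space" "zeta \<beta> [] \<in> borel_measurable port_space"
    by (rule measurable_zeta)+
  show "nondegenerate port_space (zeta \<beta> x)" "nondegenerate port_space (zeta \<beta> [])"
    using nondegenerate_zeta[OF assms(1)] x nil by blast+
  show "AE \<omega> in port_space.
      (\<lambda>n. real (deg x (PORT \<beta> \<omega> n)) / real n powr (1 / (1 + \<beta>))) \<longlonglongrightarrow> zeta \<beta> x \<omega>"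
    by (rule AE_tendsto_deg[OF assms(1) x])
  show "AE \<omega> in port_space.
      (\<lambda>n. real (deg [] (PORT \<beta> \<omega> n)) / real n powr (1 / (1 + \<beta>))) \<longlonglongrightarrow> zeta \<beta> [] \<omega>"
    by (rule AE_tendsto_deg[OF assms(1) nil])
  show "distr port_space borel (zeta \<beta> x) =
      distr (distr port_space borel (zeta \<beta> []) \<Otimes>\<^sub>M
             PiM {1..length x} (\<lambda>s. beta_measure \<beta> (real (x ! (s - 1)))))
        borel (\<lambda>(z, \<xi>). z * (\<Prod>s\<in>{1..length x}. \<xi> s))"
    by (rule distr_zeta[OF assms(1) x])
qed

end
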